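(* Let $G=(V_G,E_G)$ be a simple graph with $V_G=\{1,\dots,n\}$ and $|E_G|\geq 2$, and let $\mathbb{K}$ be a field. Let $2d$ be the greatest cardinality of an even cycle without an even-chord, or an edge-disjoint union of two odd cycles with at most one vertex in common without an even-chord, of $G$. Then $\operatorname{d}(I(G))\leq d$, and equality holds if $G$ is bipartite.
   Context: $\mathbb{K}[E_G]=\mathbb{K}[t_e: e\in E_G]$ is the (standard graded) polynomial ring with one variable for each edge of $G$. Eulerian ideal: let $\varphi:\mathbb{K}[E_G]\to\mathbb{K}[x_1,\dots,x_n]$ be the $\mathbb{K}$-algebra homomorphism with $t_e\mapsto x_ix_j$ for every edge $e=\{i,j\}$ of $G$. Then $I(G)=\varphi^{-1}\bigl((x_i^2-x_j^2 : i,j\in V_G)\bigr)$, a homogeneous ideal. $\operatorname{d}(I(G))$ denotes the maximal generating degree of $I(G)$, i.e. the maximum degree of an element of a minimal homogeneous generating set of $I(G)$. Cycles are identified with their edge sets; a cycle is even (odd) if it has an even (odd) number of edges. A subset $C\subseteq E_G$ is Eulerian if every vertex of $G$ is contained in an even number of edges of $C$. $\Delta$ denotes symmetric difference. Even-chord: let $C\subseteq E_G$ be a nonempty even cardinality Eulerian set. An edge $\ell\in E_G\setminus C$ is called an even-chord of $C$ if there are even cardinality Eulerian sets $C_1,C_2$ with $C_1\cap C_2=\{\ell\}$ and $C=C_1\Delta C_2$. *)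

theory Defs
  imports "HOL.Hull" "HOL-Library.Poly_Mapping"
begin

section \<open>Graphs\<close>

definition simple_graph :: "'v set \<Rightarrow> 'v set set \<Rightarrow> bool" where
  "simple_graph V E \<longleftrightarrow> finite V \<and> (\<forall>e\<in>E. e \<subseteq> V \<and> card e = 2)"

definition bipartite :: "'v set \<Rightarrow> 'v set set \<Rightarrow> bool" where
  "bipartite V E \<longleftrightarrow>
     (\<exists>X Y. X \<union> Y = V \<and> X \<inter> Y = {} \<and> (\<forall>e\<in>E. \<exists>x\<in>X. \<exists>y\<in>Y. e = {x, y}))"

text \<open>Cycles are identified with their edge sets.\<close>

definition cycle :: "'v set set \<Rightarrow> 'v set set \<Rightarrow> bool" where
  "cycle E C \<longleftrightarrow>
     C \<subseteq> E \<and>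
     (\<exists>vs. distinct vs \<and> length vs \<ge> 3 \<and>
        C = {{vs ! i, vs ! (Suc i mod length vs)} | i. i < length vs})"

definition even_cycle :: "'v set set \<Rightarrow> 'v set set \<Rightarrow> bool" where
  "even_cycle E C \<longleftrightarrow> cycle E C \<and> even (card C)"

definition odd_cycle :: "'v set set \<Rightarrow> 'v set set \<Rightarrow> bool" where
  "odd_cycle E C \<longleftrightarrow> cycle E C \<and> odd (card C)"

definition eulerian :: "'v set \<Rightarrow> 'v set set \<Rightarrow> 'v set set \<Rightarrow> bool" where
  "eulerian V E C \<longleftrightarrow> C \<subseteq> E \<and> (\<forall>v\<in>V. even (card {e \<in> C. v \<in> e}))"

definition even_chord :: "'v set \<Rightarrow> 'v set set \<Rightarrow> 'v set set \<Rightarrow> 'v set \<Rightarrow> bool" where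
  "even_chord V E C l \<longleftrightarrow>
     l \<in> E - C \<and>
     (\<exists>C1 C2. eulerian V E C1 \<and> even (card C1) \<and> eulerian V E C2 \<and> even (card C2) \<and>
        C1 \<inter> C2 = {l} \<and> C = sym_diff C1 C2)"

text \<open>The vertex set of a cycle \<open>A\<close> is \<open>\<Union>A\<close>.\<close>

definition even_chord_free :: "'v set \<Rightarrow> 'v set set \<Rightarrow> 'v set set set" where
  "even_chord_free V E =
     {C. (even_cycle E C \<or>
          (\<exists>A B. odd_cycle E A \<and> odd_cycle E B \<and> A \<inter> B = {} \<and>
             card (\<Union>A \<inter> \<Union>B) \<le> 1 \<and> C = A \<union> B)) \<and>
         (\<nexists>l. even_chord V E C l)}"


section \<open>Polynomial rings\<close>

text \<open>A monomial is a finitely supported exponent function \<open>'x \<Rightarrow>\<^sub>0 nat\<close>, and a polynomial is a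
  finitely supported coefficient function on monomials. The type has a variable for every
  element of \<open>'x\<close>; the ring of polynomials in the variables from \<open>X\<close> is a subring of it.\<close>

type_synonym ('x, 'k) mpoly = "('x \<Rightarrow>\<^sub>0 nat) \<Rightarrow>\<^sub>0 'k"

definition const :: "'k::comm_ring_1 \<Rightarrow> ('x, 'k) mpoly" where
  "const c = Poly_Mapping.single 0 c"

definition var :: "'x \<Rightarrow> ('x, 'k::comm_ring_1) mpoly" where
  "var x = Poly_Mapping.single (Poly_Mapping.single x 1) 1"

definition poly_ring :: "'x set \<Rightarrow> ('x, 'k::comm_ring_1) mpoly set" where
  "poly_ring X = {p. \<forall>m\<in>Poly_Mapping.keys p. Poly_Mapping.keys m \<subseteq> X}"

definition mon_deg :: "('x \<Rightarrow>\<^sub>0 nat) \<Rightarrow> nat" where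
  "mon_deg m = (\<Sum>x\<in>Poly_Mapping.keys m. Poly_Mapping.lookup m x)"

text \<open>With this definition the zero polynomial has total degree 0.\<close>

definition total_deg :: "('x, 'k::comm_ring_1) mpoly \<Rightarrow> nat" where
  "total_deg p = Max (insert 0 (mon_deg ` Poly_Mapping.keys p))"

definition homogeneous :: "('x, 'k::comm_ring_1) mpoly \<Rightarrow> bool" where
  "homogeneous p \<longleftrightarrow> (\<exists>r. \<forall>m\<in>Poly_Mapping.keys p. mon_deg m = r)"

definition is_ideal :: "'r::comm_ring_1 set \<Rightarrow> 'r set \<Rightarrow> bool" where
  "is_ideal R I \<longleftrightarrow>
     I \<subseteq> R \<and> 0 \<in> I \<and> (\<forall>p\<in>I. \<forall>q\<in>I. p + q \<in> I) \<and> (\<forall>r\<in>R. \<forall>p\<in>I. r * p \<in> I)"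

text \<open>\<open>ideal_gen R B\<close> is the smallest ideal of \<open>R\<close> containing \<open>B\<close>.\<close>

definition ideal_gen :: "'r::comm_ring_1 set \<Rightarrow> 'r set \<Rightarrow> 'r set" where
  "ideal_gen R B = is_ideal R hull B"

definition min_hom_gens ::
    "'x set \<Rightarrow> ('x, 'k::comm_ring_1) mpoly set \<Rightarrow> ('x, 'k) mpoly set \<Rightarrow> bool" where
  "min_hom_gens X I B \<longleftrightarrow>
     B \<subseteq> poly_ring X \<and> (\<forall>b\<in>B. homogeneous b) \<and> ideal_gen (poly_ring X) B = I \<and>
     (\<forall>B'. B' \<subset> B \<longrightarrow> ideal_gen (poly_ring X) B' \<noteq> I)"

text \<open>The maximal generating degree of a nonzero homogeneous ideal of the ring of polynomials in
  the (finitely many) variables from \<open>X\<close>. It does not depend on the choice of the minimal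
  homogeneous generating set.\<close>

definition max_gen_deg :: "'x set \<Rightarrow> ('x, 'k::comm_ring_1) mpoly set \<Rightarrow> nat" where
  "max_gen_deg X I = (THE m. \<exists>B. min_hom_gens X I B \<and> m = Max (total_deg ` B))"

text \<open>The algebra homomorphism with \<open>var x \<mapsto> f x\<close>; see the lemmas below.\<close>

definition subst :: "('x \<Rightarrow> ('y, 'k) mpoly) \<Rightarrow> ('x, 'k::comm_ring_1) mpoly \<Rightarrow> ('y, 'k) mpoly" where
  "subst f p = (\<Sum>m\<in>Poly_Mapping.keys p. const (Poly_Mapping.lookup p m) *
                  (\<Prod>x\<in>Poly_Mapping.keys m. f x ^ Poly_Mapping.lookup m x))"


section \<open>Eulerian ideals\<close>

text \<open>The edge \<open>{i, j}\<close> is sent to \<open>x\<^sub>i x\<^sub>j\<close>.\<close>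

definition edge_hom :: "('v set, 'k::comm_ring_1) mpoly \<Rightarrow> ('v, 'k) mpoly" where
  "edge_hom = subst (\<lambda>e. \<Prod>v\<in>e. var v)"

definition eulerian_ideal :: "'v set \<Rightarrow> 'v set set \<Rightarrow> ('v set, 'k::comm_ring_1) mpoly set" where
  "eulerian_ideal V E =
     {p \<in> poly_ring E. edge_hom p \<in>
        ideal_gen (poly_ring V) {var i ^ 2 - var j ^ 2 | i j. i \<in> V \<and> j \<in> V}}"


section \<open>The substitution map is an algebra homomorphism\<close>

lemma const_add: "const (a + b) = const a + const b"
  by (simp add: const_def single_add)

lemma const_mult: "const (a * b) = const a * const b"
  by (simp add: const_def mult_single)

lemma subst_const: "subst f (const c) = const c"
  by (cases "c = 0") (simp_all add: subst_def const_def)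

lemma subst_var: "subst f (var x) = f x"
  by (simp add: subst_def var_def const_def)

lemma subst_superset:
  assumes "finite S" "Poly_Mapping.keys p \<subseteq> S"
  shows "subst f p = (\<Sum>m\<in>S. const (Poly_Mapping.lookup p m) *
           (\<Prod>x\<in>Poly_Mapping.keys m. f x ^ Poly_Mapping.lookup m x))"
  unfolding subst_def using assms
  by (intro sum.mono_neutral_left) (auto simp: const_def in_keys_iff)

lemma subst_add: "subst f (p + q) = subst f p + subst f q"
proof -
  let ?S = "Poly_Mapping.keys p \<union> Poly_Mapping.keys q"
  have "Poly_Mapping.keys (p + q) \<subseteq> ?S" by (rule keys_add)
  then show ?thesis
    by (simp add: subst_superset[of ?S] lookup_add const_add distrib_right sum.distrib)
qed

lemma subst_sum: "subst f (\<Sum>i\<in>A. p i) = (\<Sum>i\<in>A. subst f (p i))"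
proof (induction A rule: infinite_finite_induct)
qed (simp_all add: subst_add, simp_all add: subst_def)

lemma mon_superset:
  fixes f :: "'x \<Rightarrow> 'r::comm_ring_1"
  assumes "finite S" "Poly_Mapping.keys m \<subseteq> S"
  shows "(\<Prod>x\<in>Poly_Mapping.keys m. f x ^ Poly_Mapping.lookup m x) =
         (\<Prod>x\<in>S. f x ^ Poly_Mapping.lookup m x)"
  using assms by (intro prod.mono_neutral_left) (auto simp: in_keys_iff)

lemma mon_add:
  fixes f :: "'x \<Rightarrow> 'r::comm_ring_1"
  shows "(\<Prod>x\<in>Poly_Mapping.keys (m + m'). f x ^ Poly_Mapping.lookup (m + m') x) =
     (\<Prod>x\<in>Poly_Mapping.keys m. f x ^ Poly_Mapping.lookup m x) *
     (\<Prod>x\<in>Poly_Mapping.keys m'. f x ^ Poly_Mapping.lookup m' x)"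
proof -
  let ?S = "Poly_Mapping.keys m \<union> Poly_Mapping.keys m'"
  have "Poly_Mapping.keys (m + m') \<subseteq> ?S" by (rule keys_add)
  then have "(\<Prod>x\<in>Poly_Mapping.keys (m + m'). f x ^ Poly_Mapping.lookup (m + m') x) =
      (\<Prod>x\<in>?S. f x ^ Poly_Mapping.lookup (m + m') x)"
    by (intro mon_superset) auto
  also have "\<dots> = (\<Prod>x\<in>?S. f x ^ Poly_Mapping.lookup m x) *
      (\<Prod>x\<in>?S. f x ^ Poly_Mapping.lookup m' x)"
    by (simp add: lookup_add power_add prod.distrib)
  finally show ?thesis
    by (simp add: mon_superset[of ?S m] mon_superset[of ?S m'])
qed

lemma subst_single:
  "subst f (Poly_Mapping.single m c) =
     const c * (\<Prod>x\<in>Poly_Mapping.keys m. f x ^ Poly_Mapping.lookup m x)"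
  by (cases "c = 0") (simp_all add: subst_def const_def)

lemma sum_singles:
  "p = (\<Sum>m\<in>Poly_Mapping.keys p. Poly_Mapping.single m (Poly_Mapping.lookup p m))"
  by (rule poly_mapping_eqI)
     (auto simp: lookup_sum lookup_single when_def in_keys_iff sum.delta)

lemma subst_mult: "subst f (p * q) = subst f p * subst f q"
proof -
  have "p * q = (\<Sum>m\<in>Poly_Mapping.keys p. \<Sum>m'\<in>Poly_Mapping.keys q.
      Poly_Mapping.single (m + m') (Poly_Mapping.lookup p m * Poly_Mapping.lookup q m'))"
    by (subst sum_singles[of p], subst sum_singles[of q])
       (simp add: sum_product mult_single)
  then show ?thesis
    by (simp add: subst_sum subst_single mon_add const_mult)
       (simp add: subst_def sum_product mult_ac)
qed

lemma edge_hom_var: "i \<noteq> j \<Longrightarrow> edge_hom (var {i, j}) = var i * var j"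
  by (simp add: edge_hom_def subst_var)

end

theory Submission
  imports Defs
begin

text \<open>
  Modulo the ideal generated by the differences \<open>x\<^sub>i\<^sup>2 - x\<^sub>j\<^sup>2\<close>, two monomials in the vertices agree
  exactly if they have the same degree and the same exponents modulo 2. Hence the Eulerian ideal
  is spanned by the binomials \<open>t\<^sup>a - t\<^sup>b\<close> where \<open>a\<close> and \<open>b\<close> have the same degree and the edges
  with odd exponent in \<open>a + b\<close> form an Eulerian set. All questions about generators become
  questions about connecting such monomials \<open>a\<close> and \<open>b\<close> by steps of small degree.

  For the upper bound, let \<open>a\<close> and \<open>b\<close> have degree \<open>r > d\<close>. If they share a variable, they are
  connected by induction; if one of them contains a square, the square \<open>t\<^sub>e\<^sup>2\<close> can be exchanged
  for a square \<open>t\<^sub>f\<^sup>2\<close> such that the result shares a variable with the other one. What remains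
  are squarefree monomials whose edges form two halves of an Eulerian set \<open>C\<close> with \<open>2 r\<close> edges.
  By the choice of \<open>d\<close>, this \<open>C\<close> has an even-chord or is not one of the even cycles and pairs
  of odd cycles in question; in the latter case it contains a smaller nonempty even Eulerian
  set (\<open>indecomposable_even_eulerian\<close>). In both cases, exchanging halves of a smaller even
  Eulerian set connects \<open>a\<close> and \<open>b\<close> via a third monomial (\<open>binomials_from_small_degree\<close>).

  If the graph is bipartite, there are no odd cycles, and a largest set in question is an even
  cycle \<open>C\<close> with \<open>2 d\<close> edges. Any edge that joins two vertices of \<open>C\<close> and is not in \<open>C\<close> would
  be an even-chord, so \<open>C\<close> is an induced cycle. Then the product of every second edge of \<open>C\<close>
  admits no step of degree less than \<open>d\<close> at all (\<open>matching_divisor_isolated\<close>), and the binomial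
  that relates it to the product of the other edges of \<open>C\<close> needs a generator of degree at
  least \<open>d\<close>.

  That \<^const>\<open>max_gen_deg\<close> is well-defined follows from the grading: in any
  homogeneous generating set, the elements of degree at most \<open>D\<close> generate all homogeneous
  elements of the ideal of degree at most \<open>D\<close> (\<open>hom_comp_ideal_gen\<close>).
\<close>


section \<open>Monomials and ideals\<close>

abbreviation "keys \<equiv> Poly_Mapping.keys"
abbreviation "lookup \<equiv> Poly_Mapping.lookup"
abbreviation "single \<equiv> Poly_Mapping.single"

abbreviation monom :: "('x \<Rightarrow>\<^sub>0 nat) \<Rightarrow> ('x, 'k::comm_ring_1) mpoly" where
  "monom m \<equiv> single m 1"

lemma keys_nonempty: "p \<noteq> 0 \<Longrightarrow> keys p \<noteq> {}" for p :: "'a \<Rightarrow>\<^sub>0 'b::zero"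
proof (erule contrapos_nn)
  assume "keys p = {}"
  then have "lookup p x = lookup 0 x" for x
    by (simp flip: not_in_keys_iff_lookup_eq_zero)
  then show "p = 0" by (rule poly_mapping_eqI)
qed

lemma keys_add_nat: "keys (a + b) = keys a \<union> keys b" for a b :: "'x \<Rightarrow>\<^sub>0 nat"
  by (auto simp: in_keys_iff lookup_add)

lemma mon_deg_superset:
  assumes "finite S" "keys m \<subseteq> S"
  shows "mon_deg m = (\<Sum>x\<in>S. lookup m x)"
  unfolding mon_deg_def using assms by (intro sum.mono_neutral_left) (auto simp: in_keys_iff)

lemma mon_deg_add [simp]: "mon_deg (a + b) = mon_deg a + mon_deg b"
  by (simp add: mon_deg_superset[of "keys a \<union> keys b"] keys_add_nat lookup_add sum.distrib)

lemma mon_deg_zero [simp]: "mon_deg 0 = 0"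
  by (simp add: mon_deg_def)

lemma mon_deg_single [simp]: "mon_deg (single x k) = k"
  by (simp add: mon_deg_def)

lemma mon_deg_sum: "mon_deg (\<Sum>i\<in>A. f i) = (\<Sum>i\<in>A. mon_deg (f i))"
  by (induction A rule: infinite_finite_induct) auto

lemma mon_deg_eq_0 [simp]: "mon_deg m = 0 \<longleftrightarrow> m = 0"
  unfolding mon_deg_def by (auto simp: sum_eq_0_iff in_keys_iff intro!: poly_mapping_eqI)

lemma lookup_le_mon_deg: "lookup m x \<le> mon_deg m"
  unfolding mon_deg_def
  by (cases "x \<in> keys m") (auto intro: member_le_sum simp: in_keys_iff)

lemma mon_split_power:
  fixes m :: "'x \<Rightarrow>\<^sub>0 nat"
  assumes "k \<le> lookup m x"
  obtains m' where "m = m' + single x k"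
proof
  show "m = (m - single x k) + single x k"
    using assms by (intro poly_mapping_eqI) (auto simp: lookup_add lookup_minus lookup_single when_def)
qed

lemma monom_times: "single m c * p = (\<Sum>n\<in>keys p. single (m + n) (c * lookup p n))"
  by (subst (1) sum_singles[of p]) (simp add: sum_distrib_left mult_single)

lemma lookup_monom_times:
  fixes c :: "'k::comm_ring_1" and m n :: "'x \<Rightarrow>\<^sub>0 nat"
  shows "lookup (single m c * p) (m + n) = c * lookup p n"
proof -
  have "lookup (single m c * p) (m + n) = (\<Sum>k\<in>keys p. if k = n then c * lookup p k else 0)"
    unfolding monom_times lookup_sum by (intro sum.cong) (auto simp: lookup_single when_def)
  then show ?thesis
    by (auto simp: in_keys_iff)
qed

lemma keys_monom_times: "keys (single m c * p) \<subseteq> (+) m ` keys p"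
  unfolding monom_times by (rule order.trans[OF keys_sum]) (auto split: if_splits)

lemma mult_decompose: "r * p = (\<Sum>m\<in>keys r. single m (lookup r m) * p)"
  for p r :: "('x, 'k::comm_ring_1) mpoly"
  by (subst sum_singles[of r]) (simp add: sum_distrib_right)

lemma poly_ring_single: "keys m \<subseteq> X \<Longrightarrow> single m c \<in> poly_ring X"
  by (auto simp: poly_ring_def split: if_splits)

lemma poly_ring_add: "p \<in> poly_ring X \<Longrightarrow> q \<in> poly_ring X \<Longrightarrow> p + q \<in> poly_ring X"
  using keys_add[of p q] by (auto simp: poly_ring_def)

text \<open>By distributivity, closure under multiplication needs to be checked for the multiplication
  by terms only; all the ideals below are obtained this way.\<close>

lemma is_ideal_polyI:
  fixes S :: "('x, 'k::comm_ring_1) mpoly set"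
  assumes sub: "S \<subseteq> poly_ring X" and zero: "0 \<in> S"
    and add: "\<And>p q. p \<in> S \<Longrightarrow> q \<in> S \<Longrightarrow> p + q \<in> S"
    and mult: "\<And>m c p. keys m \<subseteq> X \<Longrightarrow> p \<in> S \<Longrightarrow> single m c * p \<in> S"
  shows "is_ideal (poly_ring X) S"
proof -
  have "(\<Sum>m\<in>M. single m (lookup r m) * p) \<in> S"
    if "finite M" "\<forall>m\<in>M. keys m \<subseteq> X" "p \<in> S" for M r p
    using that by (induction M) (auto intro: zero add mult)
  then have "r * p \<in> S" if "r \<in> poly_ring X" "p \<in> S" for r p
    using that by (subst mult_decompose) (auto simp: poly_ring_def)
  then show ?thesis
    unfolding is_ideal_def using sub zero add by blast
qed

lemma is_ideal_poly_ring: "is_ideal (poly_ring X) (poly_ring X :: ('x, 'k::comm_ring_1) mpoly set)"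
proof (rule is_ideal_polyI)
  fix m :: "'x \<Rightarrow>\<^sub>0 nat" and c :: 'k and p :: "('x, 'k) mpoly"
  assume "keys m \<subseteq> X" "p \<in> poly_ring X"
  then show "single m c * p \<in> poly_ring X"
    using keys_monom_times[of m c p] by (fastforce simp: poly_ring_def keys_add_nat)
qed (auto intro: poly_ring_add, simp add: poly_ring_def)

lemma is_ideal_ideal_gen:
  fixes B :: "('x, 'k::comm_ring_1) mpoly set"
  assumes "B \<subseteq> poly_ring X"
  shows "is_ideal (poly_ring X) (ideal_gen (poly_ring X) B)"
proof -
  let ?T = "{T. is_ideal (poly_ring X) T \<and> B \<subseteq> T}"
  have "poly_ring X \<in> ?T"
    using assms is_ideal_poly_ring by blast
  moreover have "ideal_gen (poly_ring X) B = \<Inter>?T"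
    by (simp add: ideal_gen_def hull_def)
  ultimately show ?thesis
    unfolding is_ideal_def by (auto; blast)
qed

lemma ideal_gen_subset: "B \<subseteq> ideal_gen R B"
  unfolding ideal_gen_def by (rule hull_subset)

lemma ideal_gen_mono: "B \<subseteq> B' \<Longrightarrow> ideal_gen R B \<subseteq> ideal_gen R B'"
  unfolding ideal_gen_def by (rule hull_mono)

lemma ideal_gen_minimal: "is_ideal R I \<Longrightarrow> B \<subseteq> I \<Longrightarrow> ideal_gen R B \<subseteq> I"
  unfolding ideal_gen_def by (rule hull_minimal)

lemma is_ideal_mult_monom: "is_ideal (poly_ring X) I \<Longrightarrow> keys m \<subseteq> X \<Longrightarrow> p \<in> I \<Longrightarrow> single m c * p \<in> I"
  unfolding is_ideal_def using poly_ring_single by blast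

lemma is_ideal_diff:
  fixes I :: "('x, 'k::comm_ring_1) mpoly set"
  assumes "is_ideal (poly_ring X) I" "p \<in> I" "q \<in> I"
  shows "p - q \<in> I"
proof -
  have "single 0 (- 1) * q \<in> I"
    using assms by (auto intro: is_ideal_mult_monom)
  moreover have "single 0 (- 1) * q = - q"
    by (simp add: single_uminus)
  ultimately show ?thesis
    using assms(1,2) by (metis is_ideal_def add_uminus_conv_diff)
qed


section \<open>The maximal generating degree\<close>

definition hom_comp :: "nat \<Rightarrow> ('x, 'k::comm_ring_1) mpoly \<Rightarrow> ('x, 'k) mpoly" where
  "hom_comp k p = Poly_Mapping.mapp (\<lambda>m c. c when mon_deg m = k) p"

lemma lookup_hom_comp: "lookup (hom_comp k p) m = (lookup p m when mon_deg m = k)"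
  by (auto simp: hom_comp_def lookup_mapp when_def in_keys_iff)

lemma hom_comp_add: "hom_comp k (p + q) = hom_comp k p + hom_comp k q"
  by (rule poly_mapping_eqI) (simp add: lookup_hom_comp lookup_add when_def)

lemma hom_comp_zero: "hom_comp k 0 = 0"
  by (rule poly_mapping_eqI) (simp add: lookup_hom_comp)

lemma hom_comp_sum: "hom_comp k (\<Sum>i\<in>A. p i) = (\<Sum>i\<in>A. hom_comp k (p i))"
  by (induction A rule: infinite_finite_induct) (auto simp: hom_comp_zero hom_comp_add)

lemma hom_comp_single: "hom_comp k (single m c) = (if mon_deg m = k then single m c else 0)"
  by (rule poly_mapping_eqI) (auto simp: lookup_hom_comp lookup_single when_def)

lemma hom_comp_monom_times:
  "hom_comp k (single m c * p) = (if mon_deg m \<le> k then single m c * hom_comp (k - mon_deg m) p else 0)"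
proof -
  have "hom_comp k (single m c * single n b) =
      (if mon_deg m \<le> k then single m c * hom_comp (k - mon_deg m) (single n b) else 0)" for n and b :: 'b
    by (auto simp: mult_single hom_comp_single)
  then have "hom_comp k (single m c * (\<Sum>n\<in>keys p. single n (lookup p n))) =
      (if mon_deg m \<le> k then single m c * hom_comp (k - mon_deg m) (\<Sum>n\<in>keys p. single n (lookup p n)) else 0)"
    by (simp add: sum_distrib_left hom_comp_sum)
  then show ?thesis
    by (simp flip: sum_singles)
qed

lemma hom_comp_homogeneous:
  assumes "homogeneous p"
  shows "hom_comp k p = p \<or> hom_comp k p = 0"
proof -
  obtain r where "\<forall>m\<in>keys p. mon_deg m = r"
    using assms by (auto simp: homogeneous_def)
  then have "hom_comp k p = (if r = k then p else 0)"
    by (intro poly_mapping_eqI) (auto simp: lookup_hom_comp when_def in_keys_iff)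
  then show ?thesis by auto
qed

lemma total_deg_ge: "m \<in> keys p \<Longrightarrow> mon_deg m \<le> total_deg p"
  unfolding total_deg_def by (intro Max_ge) auto

lemma total_deg_leI: "(\<And>m. m \<in> keys p \<Longrightarrow> mon_deg m \<le> D) \<Longrightarrow> total_deg p \<le> D"
  unfolding total_deg_def by auto

lemma homogeneous_total_deg:
  assumes "homogeneous p"
  shows "hom_comp (total_deg p) p = p"
proof -
  obtain r where r: "\<forall>m\<in>keys p. mon_deg m = r"
    using assms by (auto simp: homogeneous_def)
  have "total_deg p = r" if ne: "p \<noteq> 0"
  proof -
    obtain m where "m \<in> keys p"
      using keys_nonempty[OF ne] by blast
    then have "r \<le> total_deg p"
      using r total_deg_ge[of m p] by simp
    moreover have "total_deg p \<le> r"
      using r by (intro total_deg_leI) simp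
    ultimately show ?thesis by simp
  qed
  then have "lookup (hom_comp (total_deg p) p) m = lookup p m" for m
    using r by (cases "p = 0") (auto simp: in_keys_iff lookup_hom_comp when_def)
  then show ?thesis by (rule poly_mapping_eqI)
qed

text \<open>A homogeneous element of degree \<open>k\<close> in the ideal generated by \<open>B\<close> only needs the
  generators of degree at most \<open>k\<close>: take the component of degree \<open>k\<close> in any representation.\<close>

lemma hom_comp_ideal_gen:
  fixes B :: "('x, 'k::comm_ring_1) mpoly set"
  assumes B: "B \<subseteq> poly_ring X" "\<forall>b\<in>B. homogeneous b" and p: "p \<in> ideal_gen (poly_ring X) B"
  shows "hom_comp k p \<in> ideal_gen (poly_ring X) {b \<in> B. total_deg b \<le> k}"
proof -
  define J where "J k = ideal_gen (poly_ring X) {b \<in> B. total_deg b \<le> k}" for k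
  have J: "is_ideal (poly_ring X) (J k)" for k
    unfolding J_def using B(1) by (intro is_ideal_ideal_gen) auto
  have J_mono: "J k \<subseteq> J l" if "k \<le> l" for k l
    unfolding J_def using that by (intro ideal_gen_mono) auto
  have "is_ideal (poly_ring X) {p \<in> poly_ring X. \<forall>k. hom_comp k p \<in> J k}"
  proof (rule is_ideal_polyI)
    fix m :: "'x \<Rightarrow>\<^sub>0 nat" and c :: 'k and p :: "('x, 'k) mpoly"
    assume m: "keys m \<subseteq> X" and p: "p \<in> {p \<in> poly_ring X. \<forall>k. hom_comp k p \<in> J k}"
    have "hom_comp k (single m c * p) \<in> J k" for k
    proof -
      have "hom_comp (k - mon_deg m) p \<in> J k"
        using p J_mono[of "k - mon_deg m" k] by auto
      then show ?thesis
        using J[of k] m by (auto simp: hom_comp_monom_times is_ideal_mult_monom is_ideal_def[of _ "J k"])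
    qed
    then show "single m c * p \<in> {p \<in> poly_ring X. \<forall>k. hom_comp k p \<in> J k}"
      using p m is_ideal_mult_monom[OF is_ideal_poly_ring] by auto
  qed (use J in \<open>auto simp: hom_comp_zero hom_comp_add poly_ring_add is_ideal_def\<close>,
       simp add: poly_ring_def)
  moreover have "B \<subseteq> {p \<in> poly_ring X. \<forall>k. hom_comp k p \<in> J k}"
  proof clarify
    fix b assume b: "b \<in> B"
    have "hom_comp k b \<in> J k" for k
    proof (cases "hom_comp k b = 0")
      case True
      then show ?thesis using J[of k] by (simp add: is_ideal_def)
    next
      case False
      then have eq: "hom_comp k b = b"
        using hom_comp_homogeneous B(2) b by blast
      have "total_deg b \<le> k"
      proof (rule total_deg_leI)
        fix m assume "m \<in> keys b"
        then show "mon_deg m \<le> k"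
          using eq lookup_hom_comp[of k b m] by (auto simp: in_keys_iff when_def split: if_splits)
      qed
      then show ?thesis
        unfolding eq J_def using b ideal_gen_subset[of "{b \<in> B. total_deg b \<le> k}"] by blast
    qed
    then show "b \<in> poly_ring X \<and> (\<forall>k. hom_comp k b \<in> J k)"
      using B b by blast
  qed
  ultimately show ?thesis
    using p ideal_gen_minimal unfolding J_def by blast
qed

text \<open>The elements of \<open>B\<close> of degree at most \<open>D\<close> generate \<open>G\<close>, hence the whole ideal, so by
  minimality they are all of \<open>B\<close>.\<close>

lemma min_hom_gens_degree_le:
  fixes B G :: "('x, 'k::comm_ring_1) mpoly set"
  assumes B: "min_hom_gens X I B"
    and G: "\<forall>g\<in>G. homogeneous g \<and> total_deg g \<le> D" "ideal_gen (poly_ring X) G = I"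
    and b: "b \<in> B"
  shows "total_deg b \<le> D"
proof -
  let ?B = "{b \<in> B. total_deg b \<le> D}"
  have B': "B \<subseteq> poly_ring X" "\<forall>b\<in>B. homogeneous b" "ideal_gen (poly_ring X) B = I"
    using B by (auto simp: min_hom_gens_def)
  have "G \<subseteq> ideal_gen (poly_ring X) ?B"
  proof
    fix g assume g: "g \<in> G"
    then have "g \<in> ideal_gen (poly_ring X) B"
      unfolding B'(3) G(2)[symmetric] using ideal_gen_subset[of G] by blast
    from hom_comp_ideal_gen[OF B'(1,2) this]
    have "g \<in> ideal_gen (poly_ring X) {b \<in> B. total_deg b \<le> total_deg g}"
      using G(1) g homogeneous_total_deg by metis
    then show "g \<in> ideal_gen (poly_ring X) ?B"
      using G(1) g ideal_gen_mono[of "{b \<in> B. total_deg b \<le> total_deg g}" ?B "poly_ring X"]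
      by (auto intro: order.trans)
  qed
  then have "I \<subseteq> ideal_gen (poly_ring X) ?B"
    unfolding G(2)[symmetric] using B'(1) by (intro ideal_gen_minimal is_ideal_ideal_gen) auto
  moreover have "ideal_gen (poly_ring X) ?B \<subseteq> I"
    unfolding B'(3)[symmetric] by (rule ideal_gen_mono) auto
  ultimately have "ideal_gen (poly_ring X) ?B = I"
    by (rule antisym[rotated])
  then have "\<not> ?B \<subset> B"
    using B unfolding min_hom_gens_def by blast
  then show ?thesis using b by blast
qed

lemma ex_min_hom_gens:
  fixes G :: "('x, 'k::comm_ring_1) mpoly set"
  assumes "finite G" "G \<subseteq> poly_ring X" "\<forall>g\<in>G. homogeneous g" "ideal_gen (poly_ring X) G = I"
  shows "\<exists>B. min_hom_gens X I B"
  using assms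
proof (induction G rule: finite_psubset_induct)
  case (psubset G)
  show ?case
  proof (cases "\<exists>B. B \<subset> G \<and> ideal_gen (poly_ring X) B = I")
    case True
    then obtain B where "B \<subset> G" "ideal_gen (poly_ring X) B = I" by blast
    moreover from this have "B \<subseteq> poly_ring X" "\<forall>g\<in>B. homogeneous g"
      using psubset.prems by auto
    ultimately show ?thesis using psubset.IH[of B] by simp
  next
    case False
    then have "min_hom_gens X I G"
      using psubset.prems by (simp add: min_hom_gens_def)
    then show ?thesis ..
  qed
qed

text \<open>Comparing two minimal homogeneous generating sets with each other shows that their maximal
  degrees agree, so the description that defines \<^const>\<open>max_gen_deg\<close> denotes. The finite
  generating set \<open>G\<close> provides the existence of a minimal one. In the zero ideal, the minimal
  generating set is empty and has no maximal degree.\<close>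

lemma max_gen_deg_attained:
  fixes G :: "('x, 'k::comm_ring_1) mpoly set"
  assumes G: "finite G" "G \<subseteq> poly_ring X" "\<forall>g\<in>G. homogeneous g \<and> total_deg g \<le> D"
      "ideal_gen (poly_ring X) G = I"
    and I: "I \<noteq> {0}"
  obtains B where "min_hom_gens X I B" "\<forall>b\<in>B. total_deg b \<le> max_gen_deg X I" "max_gen_deg X I \<le> D"
proof -
  let ?R = "poly_ring X"
  obtain B where B: "min_hom_gens X I B"
    using ex_min_hom_gens[of G X I] G by auto
  have bound: "\<forall>b\<in>B'. total_deg b \<le> D" if "min_hom_gens X I B'" for B'
    using min_hom_gens_degree_le[OF that G(3,4)] by simp
  have fin: "finite (total_deg ` B')" if "min_hom_gens X I B'" for B'
    using bound[OF that] by (auto simp: finite_nat_set_iff_bounded_le)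
  have ne: "B' \<noteq> {}" if "min_hom_gens X I B'" for B'
  proof
    assume "B' = {}"
    moreover have "is_ideal ?R {0 :: ('x, 'k) mpoly}"
      by (rule is_ideal_polyI) (auto simp: poly_ring_def)
    ultimately have "I \<subseteq> {0}"
      using that ideal_gen_minimal[of ?R "{0}" B'] by (simp add: min_hom_gens_def)
    moreover have "0 \<in> I"
      using that is_ideal_ideal_gen[of B' X] by (simp add: min_hom_gens_def is_ideal_def)
    ultimately show False using I by blast
  qed
  have le: "Max (total_deg ` B1) \<le> Max (total_deg ` B2)"
    if 1: "min_hom_gens X I B1" and 2: "min_hom_gens X I B2" for B1 B2
  proof -
    have "total_deg b \<le> Max (total_deg ` B2)" if "b \<in> B1" for b
    proof (rule min_hom_gens_degree_le[OF 1 _ _ that])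
      show "\<forall>g\<in>B2. homogeneous g \<and> total_deg g \<le> Max (total_deg ` B2)"
        using 2 fin[OF 2] unfolding min_hom_gens_def by simp
      show "ideal_gen ?R B2 = I"
        using 2 by (simp add: min_hom_gens_def)
    qed
    then show ?thesis
      using fin[OF 1] ne[OF 1] by auto
  qed
  have eq: "max_gen_deg X I = Max (total_deg ` B)"
    unfolding max_gen_deg_def
  proof (rule the_equality)
    show "\<exists>B'. min_hom_gens X I B' \<and> Max (total_deg ` B) = Max (total_deg ` B')"
      using B by auto
    fix m assume "\<exists>B'. min_hom_gens X I B' \<and> m = Max (total_deg ` B')"
    then show "m = Max (total_deg ` B)"
      using le[OF B] le[OF _ B] by (metis antisym)
  qed
  show thesis
  proof (rule that)
    show "min_hom_gens X I B" by (rule B)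
    show "\<forall>b\<in>B. total_deg b \<le> max_gen_deg X I"
      using fin[OF B] by (simp add: eq)
    show "max_gen_deg X I \<le> D"
      using fin[OF B] ne[OF B] bound[OF B] by (simp add: eq)
  qed
qed


section \<open>The binomials in an Eulerian ideal\<close>

text \<open>The exponent of the image of a monomial under \<^const>\<open>edge_hom\<close>.\<close>

definition vdeg :: "('v set \<Rightarrow>\<^sub>0 nat) \<Rightarrow> ('v \<Rightarrow>\<^sub>0 nat)" where
  "vdeg m = (\<Sum>e\<in>keys m. \<Sum>i<lookup m e. \<Sum>v\<in>e. single v 1)"

text \<open>The equivalence relation on vertex monomials that is generated by exchanging the square of
  one variable for the square of another.\<close>

definition parity_eq :: "('v \<Rightarrow>\<^sub>0 nat) \<Rightarrow> ('v \<Rightarrow>\<^sub>0 nat) \<Rightarrow> bool" where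
  "parity_eq x y \<longleftrightarrow> mon_deg x = mon_deg y \<and> (\<forall>v. even (lookup x v) = even (lookup y v))"

lemma prod_monom: "(\<Prod>i\<in>A. monom (f i)) = monom (\<Sum>i\<in>A. f i)"
  by (induction A rule: infinite_finite_induct) (auto simp: mult_single)

lemma edge_hom_single:
  fixes c :: "'k::comm_ring_1" and m :: "'v set \<Rightarrow>\<^sub>0 nat"
  shows "edge_hom (single m c) = single (vdeg m) c"
proof -
  have "(\<Prod>v\<in>e. var v) ^ k = (monom :: _ \<Rightarrow> (_, 'k) mpoly) (\<Sum>i<k. \<Sum>v\<in>e. single v 1)" for e :: "'v set" and k
    using prod_monom[of "\<lambda>_. \<Sum>v\<in>e. single v 1" "{..<k}"] by (simp add: var_def prod_monom)
  then show ?thesis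
    by (simp add: edge_hom_def subst_single prod_monom vdeg_def const_def mult_single)
qed

lemma edge_hom_sum: "edge_hom p = (\<Sum>m\<in>keys p. single (vdeg m) (lookup p m))"
  using arg_cong[OF sum_singles[of p], of edge_hom]
  by (simp add: edge_hom_def subst_sum flip: edge_hom_single)

lemma vdeg_superset:
  assumes "finite S" "keys m \<subseteq> S"
  shows "vdeg m = (\<Sum>e\<in>S. \<Sum>i<lookup m e. \<Sum>v\<in>e. single v 1)"
  unfolding vdeg_def using assms by (intro sum.mono_neutral_left) (auto simp: in_keys_iff)

lemma vdeg_add: "vdeg (a + b) = vdeg a + vdeg b"
proof (rule poly_mapping_eqI)
  fix v
  show "lookup (vdeg (a + b)) v = lookup (vdeg a + vdeg b) v"
    by (simp add: vdeg_superset[of "keys a \<union> keys b"] keys_add_nat lookup_add lookup_sum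
        sum.distrib distrib_right)
qed

lemma lookup_vdeg:
  assumes "\<forall>e\<in>keys m. finite e"
  shows "lookup (vdeg m) v = (\<Sum>e\<in>keys m. if v \<in> e then lookup m e else 0)"
  unfolding vdeg_def lookup_sum
  by (rule sum.cong) (use assms in \<open>auto simp: lookup_single when_def\<close>)

lemma parity_eq_cong: "parity_eq x y \<Longrightarrow> parity_eq (z + x) (z + y)"
  by (auto simp: parity_eq_def lookup_add)


subsection \<open>The ideal generated by the differences of squares\<close>

abbreviation square_ideal :: "'v set \<Rightarrow> ('v, 'k::comm_ring_1) mpoly set" where
  "square_ideal V \<equiv> ideal_gen (poly_ring V) {var i ^ 2 - var j ^ 2 | i j. i \<in> V \<and> j \<in> V}"

lemma var_square: "var i ^ 2 = monom (single i 2)"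
  by (simp add: var_def power2_eq_square mult_single flip: single_add) (simp add: numeral_2_eq_2)

lemma is_ideal_square_ideal:
  "is_ideal (poly_ring V) (square_ideal V :: ('v, 'k::comm_ring_1) mpoly set)"
proof (rule is_ideal_ideal_gen, clarify)
  fix i j assume "i \<in> V" "j \<in> V"
  then have "{i, j} \<subseteq> V" by blast
  then show "var i ^ 2 - var j ^ 2 \<in> (poly_ring V :: ('v, 'k) mpoly set)"
    unfolding var_square
    by (intro is_ideal_diff[OF is_ideal_poly_ring] poly_ring_single) auto
qed

text \<open>If \<open>x \<noteq> y\<close> have the same degree and parities, then \<open>x\<close> is divisible by the square of a
  variable and so is \<open>y\<close>. Exchanging one square for the other reduces to smaller degree.\<close>

lemma parity_eq_diff_in_square_ideal:
  assumes "keys x \<subseteq> V" "keys y \<subseteq> V" "parity_eq x y"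
  shows "monom x - monom y \<in> (square_ideal V :: ('v, 'k::comm_ring_1) mpoly set)"
  using assms
proof (induction "mon_deg x" arbitrary: x y rule: less_induct)
  case less
  let ?J = "square_ideal V :: ('v, 'k) mpoly set"
  have J: "is_ideal (poly_ring V) ?J"
    by (rule is_ideal_square_ideal)
  \<comment> \<open>If all exponents of \<open>z\<close> were at most one, then \<open>z\<close> would be below \<open>z'\<close> by parity, and equal
    to it by degree.\<close>
  have big: "\<exists>i. 2 \<le> lookup z i"
    if "parity_eq z z'" "z \<noteq> z'" for z z' :: "'v \<Rightarrow>\<^sub>0 nat"
  proof (rule ccontr)
    assume small: "\<not> (\<exists>i. 2 \<le> lookup z i)"
    have le: "lookup z i \<le> lookup z' i" for i
    proof -
      have "lookup z i < 2" using small by (metis not_le)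
      moreover have "even (lookup z i) = even (lookup z' i)"
        using that by (auto simp: parity_eq_def)
      ultimately show ?thesis by (cases "lookup z' i") (auto simp: less_2_cases_iff)
    qed
    let ?S = "keys z \<union> keys z'"
    have "sum (lookup z) ?S = sum (lookup z') ?S"
      using that(1) by (simp add: parity_eq_def mon_deg_superset[of ?S])
    then have "\<forall>i\<in>?S. lookup z i = lookup z' i"
      using sum_mono_inv[of "lookup z" ?S "lookup z'"] le by auto
    then have "lookup z i = lookup z' i" for i
      by (cases "i \<in> ?S") (auto simp: in_keys_iff)
    then show False using that(2) poly_mapping_eqI by blast
  qed
  show ?case
  proof (cases "x = y")
    case True
    then show ?thesis using J by (simp add: is_ideal_def)
  next
    case False
    have "parity_eq y x" using less.prems by (auto simp: parity_eq_def)
    then obtain i j where "2 \<le> lookup x i" "2 \<le> lookup y j"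
      using big less.prems(3) False by metis
    then obtain x' y' where xy: "x = x' + single i 2" "y = y' + single j 2"
      using mon_split_power by metis
    have ij: "i \<in> V" "j \<in> V" "keys x' \<subseteq> V" "keys y' \<subseteq> V"
      using less.prems(1,2) by (auto simp: xy keys_add_nat)
    have "even (lookup x' v) = even (lookup y' v)" for v
    proof -
      have "even (lookup x v) = even (lookup y v)"
        using less.prems(3) by (simp add: parity_eq_def)
      then show ?thesis
        by (simp add: xy lookup_add lookup_single when_def split: if_splits)
    qed
    then have "parity_eq x' y'"
      using less.prems(3) by (simp add: parity_eq_def xy)
    then have "monom x' - monom y' \<in> ?J"
      using less.hyps[of x' y'] ij by (simp add: xy)
    then have "monom (single i 2) * (monom x' - monom y') \<in> ?J"
      using J ij by (intro is_ideal_mult_monom) auto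
    moreover have "monom y' * (var i ^ 2 - var j ^ 2) \<in> ?J"
      using J ij by (intro is_ideal_mult_monom ideal_gen_subset[THEN subsetD]) auto
    moreover have "monom x - monom y =
        monom (single i 2) * (monom x' - monom y') + monom y' * (var i ^ 2 - var j ^ 2 :: ('v, 'k) mpoly)"
      by (simp add: xy var_square algebra_simps mult_single)
    ultimately show ?thesis using J by (simp add: is_ideal_def)
  qed
qed

definition weighted_sum :: "('m \<Rightarrow> 'k::comm_ring_1) \<Rightarrow> ('m \<Rightarrow>\<^sub>0 'k) \<Rightarrow> 'k" where
  "weighted_sum w p = (\<Sum>m\<in>keys p. w m * lookup p m)"

lemma weighted_sum_add: "weighted_sum w (p + q) = weighted_sum w p + weighted_sum w q"
proof -
  have *: "weighted_sum w r = (\<Sum>m\<in>keys p \<union> keys q. w m * lookup r m)"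
    if "keys r \<subseteq> keys p \<union> keys q" for r
    unfolding weighted_sum_def using that by (intro sum.mono_neutral_left) (auto simp: in_keys_iff)
  show ?thesis
    using keys_add[of p q] by (simp add: * lookup_add distrib_left sum.distrib)
qed

lemma weighted_sum_zero: "weighted_sum w 0 = 0"
  by (simp add: weighted_sum_def)

lemma weighted_sum_sum: "weighted_sum w (\<Sum>i\<in>A. p i) = (\<Sum>i\<in>A. weighted_sum w (p i))"
  by (induction A rule: infinite_finite_induct) (simp_all add: weighted_sum_zero weighted_sum_add)

lemma weighted_sum_single: "weighted_sum w (single m c) = w m * c"
  by (simp add: weighted_sum_def)

lemma weighted_sum_monom_times:
  "weighted_sum w (single m c * p) = c * weighted_sum (\<lambda>n. w (m + n)) p"
  by (simp add: monom_times weighted_sum_sum weighted_sum_single)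
     (simp add: weighted_sum_def sum_distrib_left mult_ac)

text \<open>A weight that is constant on the classes of \<^const>\<open>parity_eq\<close> gives a linear form that
  kills the differences of squares. As \<^const>\<open>parity_eq\<close> is a congruence, the translates of
  such a weight have the same property, so these forms kill the whole ideal.\<close>

lemma weighted_sum_square_ideal:
  fixes w :: "('v \<Rightarrow>\<^sub>0 nat) \<Rightarrow> 'k::comm_ring_1"
  assumes w: "\<And>x y. parity_eq x y \<Longrightarrow> w x = w y" and q: "q \<in> square_ideal V"
  shows "weighted_sum w q = 0"
proof -
  define inv :: "(('v \<Rightarrow>\<^sub>0 nat) \<Rightarrow> 'k) \<Rightarrow> bool" where
    "inv = (\<lambda>w. \<forall>x y. parity_eq x y \<longrightarrow> w x = w y)"
  let ?Z = "{q \<in> poly_ring V. \<forall>w. inv w \<longrightarrow> weighted_sum w q = 0}"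
  have "is_ideal (poly_ring V) ?Z"
  proof (rule is_ideal_polyI)
    fix m :: "'v \<Rightarrow>\<^sub>0 nat" and c :: 'k and p assume m: "keys m \<subseteq> V" and p: "p \<in> ?Z"
    have "inv (\<lambda>n. w (m + n))" if "inv w" for w
      using that by (auto simp: inv_def intro: parity_eq_cong)
    then show "single m c * p \<in> ?Z"
      using p m by (simp add: weighted_sum_monom_times is_ideal_mult_monom[OF is_ideal_poly_ring])
  qed (auto simp: weighted_sum_zero weighted_sum_add intro: poly_ring_add, simp add: poly_ring_def)
  moreover have "var i ^ 2 - var j ^ 2 \<in> ?Z" if "i \<in> V" "j \<in> V" for i j
  proof -
    have "weighted_sum w (var i ^ 2 - var j ^ 2) = 0" if "inv w" for w
    proof -
      have "w (single i 2) = w (single j 2)"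
        using that by (auto simp: inv_def parity_eq_def lookup_single when_def)
      moreover have "var i ^ 2 - var j ^ 2 = monom (single i 2) + single (single j 2) (- 1 :: 'k)"
        by (simp add: var_square single_uminus)
      ultimately show ?thesis
        by (simp add: weighted_sum_add weighted_sum_single)
    qed
    moreover have "var i ^ 2 - var j ^ 2 \<in> (poly_ring V :: ('v, 'k) mpoly set)"
      unfolding var_square using that
      by (intro is_ideal_diff[OF is_ideal_poly_ring] poly_ring_single) auto
    ultimately show ?thesis by blast
  qed
  ultimately have "square_ideal V \<subseteq> ?Z"
    by (intro ideal_gen_minimal) auto
  then show ?thesis
    using q w by (auto simp: inv_def)
qed

subsection \<open>Binomials generate the Eulerian ideal\<close>

text \<open>For a simple graph with edge set \<open>E\<close>, this relation holds between two monomials in the edges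
  exactly if their difference lies in the Eulerian ideal.\<close>

definition edge_sim :: "'v set set \<Rightarrow> ('v set \<Rightarrow>\<^sub>0 nat) \<Rightarrow> ('v set \<Rightarrow>\<^sub>0 nat) \<Rightarrow> bool" where
  "edge_sim E a b \<longleftrightarrow> keys a \<subseteq> E \<and> keys b \<subseteq> E \<and> mon_deg a = mon_deg b \<and>
     (\<forall>v. even (lookup (vdeg a) v) = even (lookup (vdeg b) v))"

locale graph =
  fixes V :: "'v set" and E :: "'v set set"
  assumes simple: "simple_graph V E"
begin

lemma finite_V: "finite V" and edge_subset: "e \<in> E \<Longrightarrow> e \<subseteq> V" and edge_card: "e \<in> E \<Longrightarrow> card e = 2"
  using simple by (auto simp: simple_graph_def)

lemma finite_edge: "e \<in> E \<Longrightarrow> finite e"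
  using edge_card card_gt_0_iff by fastforce

lemma finite_E: "finite E"
  using finite_V edge_subset by (meson PowI finite_Pow_iff finite_subset subsetI)

lemma mon_deg_vdeg:
  assumes "keys a \<subseteq> E"
  shows "mon_deg (vdeg a) = 2 * mon_deg a"
proof -
  have "mon_deg (vdeg a) = (\<Sum>e\<in>keys a. lookup a e * card e)"
    by (simp add: vdeg_def mon_deg_sum)
  also have "\<dots> = (\<Sum>e\<in>keys a. 2 * lookup a e)"
    using assms edge_card by (intro sum.cong) auto
  finally show ?thesis
    by (simp add: mon_deg_def sum_distrib_left)
qed

lemma keys_vdeg: "keys a \<subseteq> E \<Longrightarrow> keys (vdeg a) \<subseteq> V"
  unfolding vdeg_def using edge_subset
  by (intro order.trans[OF keys_sum] UN_least) auto

lemma edge_sim_parity_eq: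
  "keys a \<subseteq> E \<Longrightarrow> keys b \<subseteq> E \<Longrightarrow> edge_sim E a b \<longleftrightarrow> parity_eq (vdeg a) (vdeg b)"
  by (simp add: edge_sim_def parity_eq_def mon_deg_vdeg)

lemma is_ideal_eulerian_ideal:
  "is_ideal (poly_ring E) (eulerian_ideal V E :: ('v set, 'k::comm_ring_1) mpoly set)"
proof (rule is_ideal_polyI)
  note J = is_ideal_square_ideal[of V, where 'k = 'k]
  show "0 \<in> (eulerian_ideal V E :: ('v set, 'k) mpoly set)"
    using J by (simp add: eulerian_ideal_def is_ideal_def poly_ring_def edge_hom_def subst_def)
  fix p q :: "('v set, 'k) mpoly"
  show "p + q \<in> eulerian_ideal V E" if "p \<in> eulerian_ideal V E" "q \<in> eulerian_ideal V E"
    using that J by (auto simp: eulerian_ideal_def is_ideal_def edge_hom_def subst_add poly_ring_add)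
  show "single m c * p \<in> eulerian_ideal V E" if "keys m \<subseteq> E" "p \<in> eulerian_ideal V E" for m c
  proof -
    have "edge_hom (single m c * p) = single (vdeg m) c * edge_hom p"
      by (simp add: edge_hom_def subst_mult flip: edge_hom_single[unfolded edge_hom_def])
    then show ?thesis
      using that is_ideal_mult_monom[OF J keys_vdeg]
      by (simp add: eulerian_ideal_def is_ideal_mult_monom[OF is_ideal_poly_ring])
  qed
qed (auto simp: eulerian_ideal_def)

lemma edge_sim_diff_in_eulerian_ideal:
  assumes "edge_sim E a b"
  shows "monom a - monom b \<in> (eulerian_ideal V E :: ('v set, 'k::comm_ring_1) mpoly set)"
proof -
  have keys: "keys a \<subseteq> E" "keys b \<subseteq> E"
    using assms by (auto simp: edge_sim_def)
  have eq: "monom a - monom b = monom a + single b (- 1 :: 'k)"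
    by (simp add: single_uminus)
  have "edge_hom (monom a - monom b) = monom (vdeg a) + single (vdeg b) (- 1 :: 'k)"
    unfolding eq edge_hom_def subst_add by (simp add: edge_hom_single[unfolded edge_hom_def])
  also have "\<dots> = monom (vdeg a) - monom (vdeg b)"
    by (simp add: single_uminus)
  also have "\<dots> \<in> square_ideal V"
    using assms keys by (intro parity_eq_diff_in_square_ideal keys_vdeg) (auto simp: edge_sim_parity_eq)
  finally show ?thesis
    using keys by (simp add: eulerian_ideal_def is_ideal_diff[OF is_ideal_poly_ring] poly_ring_single)
qed

text \<open>The coefficients of an element of the ideal sum to zero over every class of
  \<^const>\<open>edge_sim\<close>, so no class contains exactly one of its terms.\<close>

lemma eulerian_ideal_partner:
  fixes p :: "('v set, 'k::comm_ring_1) mpoly"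
  assumes p: "p \<in> eulerian_ideal V E" and a: "a \<in> keys p"
  obtains b where "b \<in> keys p" "b \<noteq> a" "edge_sim E a b"
proof -
  have keys: "keys m \<subseteq> E" if "m \<in> keys p" for m
    using p that by (auto simp: eulerian_ideal_def poly_ring_def)
  define w :: "('v \<Rightarrow>\<^sub>0 nat) \<Rightarrow> 'k" where "w x = (if parity_eq (vdeg a) x then 1 else 0)" for x
  have "weighted_sum w (edge_hom p) = 0"
  proof (rule weighted_sum_square_ideal)
    show "edge_hom p \<in> square_ideal V"
      using p by (simp add: eulerian_ideal_def)
    show "w x = w y" if "parity_eq x y" for x y
      using that by (auto simp: w_def parity_eq_def)
  qed
  then have sum0: "(\<Sum>m\<in>keys p. w (vdeg m) * lookup p m) = 0"
    unfolding edge_hom_sum by (simp add: weighted_sum_sum weighted_sum_single)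
  have "\<exists>b\<in>keys p. b \<noteq> a \<and> edge_sim E a b"
  proof (rule ccontr)
    assume *: "\<not> ?thesis"
    have "w (vdeg m) * lookup p m = (if m = a then lookup p a else 0)" if "m \<in> keys p" for m
    proof (cases "m = a")
      case True
      then show ?thesis by (simp add: w_def parity_eq_def)
    next
      case False
      then have "\<not> parity_eq (vdeg a) (vdeg m)"
        using * that a keys edge_sim_parity_eq by blast
      then show ?thesis using False by (simp add: w_def)
    qed
    then have "(\<Sum>m\<in>keys p. w (vdeg m) * lookup p m) = (\<Sum>m\<in>keys p. if m = a then lookup p a else 0)"
      by (intro sum.cong) auto
    also have "\<dots> = lookup p a" using a by simp
    finally show False using sum0 a by (simp add: in_keys_iff)
  qed
  then show thesis using that by blast
qed

text \<open>Subtracting a suitable multiple of the binomial of a term and its partner cancels the former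
  and creates no new term.\<close>

lemma eulerian_ideal_subset:
  fixes S :: "('v set, 'k::comm_ring_1) mpoly set"
  assumes S: "is_ideal (poly_ring E) S"
    and binom: "\<And>a b. edge_sim E a b \<Longrightarrow> monom a - monom b \<in> S"
  shows "eulerian_ideal V E \<subseteq> S"
proof
  fix p :: "('v set, 'k) mpoly"
  assume "p \<in> eulerian_ideal V E"
  then show "p \<in> S"
  proof (induction "card (keys p)" arbitrary: p rule: less_induct)
    case less
    show ?case
    proof (cases "p = 0")
      case True
      then show ?thesis using S by (simp add: is_ideal_def)
    next
      case False
      then obtain a where a: "a \<in> keys p" using keys_nonempty by blast
      then obtain b where b: "b \<in> keys p" "b \<noteq> a" "edge_sim E a b"
        using eulerian_ideal_partner[OF less.prems] by metis
      define c where "c = lookup p a"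
      define p' where "p' = p - single 0 c * (monom a - monom b)"
      have p': "p' = p - single a c + single b c"
        by (simp add: p'_def right_diff_distrib mult_single)
      have "keys p' \<subseteq> keys p - {a}"
        using b by (auto simp: p' in_keys_iff lookup_add lookup_minus lookup_single when_def c_def split: if_splits)
      then have "card (keys p') < card (keys p)"
        using a by (intro psubset_card_mono) auto
      moreover have "p' \<in> eulerian_ideal V E"
        unfolding p'_def using less.prems b(3)
        by (intro is_ideal_diff[OF is_ideal_eulerian_ideal] is_ideal_mult_monom[OF is_ideal_eulerian_ideal]
            edge_sim_diff_in_eulerian_ideal) auto
      ultimately have "p' \<in> S" by (rule less.hyps)
      moreover have "single 0 c * (monom a - monom b) \<in> S"
        using binom[OF b(3)] by (intro is_ideal_mult_monom[OF S]) auto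
      ultimately have "p' + single 0 c * (monom a - monom b) \<in> S"
        using S by (simp add: is_ideal_def)
      then show ?thesis by (simp add: p'_def)
    qed
  qed
qed

end


section \<open>Cycles and Eulerian sets\<close>

definition odd_at :: "'v set set \<Rightarrow> 'v \<Rightarrow> bool" where
  "odd_at C v \<longleftrightarrow> odd (card {e \<in> C. v \<in> e})"

lemma odd_at_empty [simp]: "\<not> odd_at {} v"
  by (simp add: odd_at_def)

lemma odd_at_Un:
  assumes "finite A" "finite B" "A \<inter> B = {}"
  shows "odd_at (A \<union> B) v \<longleftrightarrow> odd_at A v \<noteq> odd_at B v"
proof -
  have "{e \<in> A \<union> B. v \<in> e} = {e \<in> A. v \<in> e} \<union> {e \<in> B. v \<in> e}" by auto
  then have "card {e \<in> A \<union> B. v \<in> e} = card {e \<in> A. v \<in> e} + card {e \<in> B. v \<in> e}"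
    using assms by (simp, intro card_Un_disjoint) auto
  then show ?thesis by (auto simp: odd_at_def)
qed

lemma odd_at_single: "odd_at {e} v \<longleftrightarrow> v \<in> e"
proof -
  have "{f \<in> {e}. v \<in> f} = (if v \<in> e then {e} else {})" by auto
  then show ?thesis by (simp add: odd_at_def)
qed

lemma odd_at_insert: "finite A \<Longrightarrow> e \<notin> A \<Longrightarrow> odd_at (insert e A) v \<longleftrightarrow> (v \<in> e) \<noteq> odd_at A v"
  using odd_at_Un[of "{e}" A v] by (simp add: odd_at_single)

lemma odd_at_Diff:
  assumes "finite A" "B \<subseteq> A"
  shows "odd_at (A - B) v \<longleftrightarrow> odd_at A v \<noteq> odd_at B v"
proof -
  have "finite B" using assms finite_subset by blast
  then have "odd_at ((A - B) \<union> B) v \<longleftrightarrow> odd_at (A - B) v \<noteq> odd_at B v"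
    using assms by (intro odd_at_Un) auto
  moreover have "(A - B) \<union> B = A" using assms by auto
  ultimately show ?thesis by auto
qed

lemma odd_at_sym_diff:
  assumes "finite A" "finite B"
  shows "odd_at (sym_diff A B) v \<longleftrightarrow> odd_at A v \<noteq> odd_at B v"
proof -
  have "odd_at (sym_diff A B) v \<longleftrightarrow> odd_at (A - A \<inter> B) v \<noteq> odd_at (B - A \<inter> B) v"
    using assms odd_at_Un[of "A - B" "B - A" v] by (auto simp: Diff_Int_distrib Diff_Int)
  then show ?thesis
    using odd_at_Diff[of A "A \<inter> B" v] odd_at_Diff[of B "A \<inter> B" v] assms by auto
qed

definition path_edges :: "'v list \<Rightarrow> nat \<Rightarrow> nat \<Rightarrow> 'v set set" where
  "path_edges vs i j = (\<lambda>k. {vs ! k, vs ! Suc k}) ` {i..<j}"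

lemma finite_path_edges [simp]: "finite (path_edges vs i j)"
  by (simp add: path_edges_def)

lemma path_edges_parity_card:
  assumes "distinct vs" "i \<le> j" "j < length vs"
  shows "odd_at (path_edges vs i j) v \<longleftrightarrow> (v = vs ! i) \<noteq> (v = vs ! j)"
    and "card (path_edges vs i j) = j - i"
proof -
  have "(\<forall>v. odd_at (path_edges vs i j) v \<longleftrightarrow> (v = vs ! i) \<noteq> (v = vs ! j)) \<and>
      card (path_edges vs i j) = j - i"
    using assms(2,3)
  proof (induction j rule: dec_induct)
    case base
    then show ?case by (simp add: path_edges_def)
  next
    case (step j)
    have new: "{vs ! j, vs ! Suc j} \<notin> path_edges vs i j"
    proof
      assume "{vs ! j, vs ! Suc j} \<in> path_edges vs i j"
      then obtain k where "k < j" "{vs ! j, vs ! Suc j} = {vs ! k, vs ! Suc k}"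
        by (auto simp: path_edges_def)
      then have "vs ! Suc j = vs ! k \<or> vs ! Suc j = vs ! Suc k" by blast
      then show False
        using assms(1) step.prems \<open>k < j\<close> by (auto simp: nth_eq_iff_index_eq)
    qed
    have ins: "path_edges vs i (Suc j) = insert {vs ! j, vs ! Suc j} (path_edges vs i j)"
      using step.hyps by (simp add: path_edges_def atLeastLessThanSuc)
    have ne: "vs ! j \<noteq> vs ! Suc j"
      using assms(1) step.prems by (simp add: nth_eq_iff_index_eq)
    have IH: "odd_at (path_edges vs i j) v \<longleftrightarrow> (v = vs ! i) \<noteq> (v = vs ! j)"
        "card (path_edges vs i j) = j - i" for v
      using step.IH step.prems by auto
    show ?case
    proof (intro conjI allI)
      show "odd_at (path_edges vs i (Suc j)) v \<longleftrightarrow> (v = vs ! i) \<noteq> (v = vs ! Suc j)" for v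
        unfolding ins odd_at_insert[OF finite_path_edges new] IH
        by (cases "v = vs ! j"; cases "v = vs ! Suc j") (use ne in simp_all)
      show "card (path_edges vs i (Suc j)) = Suc j - i"
        using new step.hyps by (simp add: ins IH)
    qed
  qed
  then show "odd_at (path_edges vs i j) v \<longleftrightarrow> (v = vs ! i) \<noteq> (v = vs ! j)"
    and "card (path_edges vs i j) = j - i" by auto
qed

lemma cycle_edges:
  assumes "length vs \<ge> 3"
  shows "{{vs ! i, vs ! (Suc i mod length vs)} | i. i < length vs} =
    insert {vs ! (length vs - 1), vs ! 0} (path_edges vs 0 (length vs - 1))" (is "?C = ?P")
proof -
  have *: "{..<length vs} = insert (length vs - 1) {0..<length vs - 1}"
    using assms by auto
  have last: "Suc (length vs - 1) = length vs"
    using assms by simp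
  have "?C = (\<lambda>i. {vs ! i, vs ! (Suc i mod length vs)}) ` {..<length vs}" by blast
  also have "\<dots> = insert {vs ! (length vs - 1), vs ! (length vs mod length vs)}
      ((\<lambda>i. {vs ! i, vs ! (Suc i mod length vs)}) ` {0..<length vs - 1})"
    unfolding * image_insert last by (rule refl)
  also have "(\<lambda>i. {vs ! i, vs ! (Suc i mod length vs)}) ` {0..<length vs - 1} =
      path_edges vs 0 (length vs - 1)"
    unfolding path_edges_def by (rule image_cong) auto
  finally show ?thesis by simp
qed

lemma closing_edge_notin_path:
  assumes "distinct vs" "length vs \<ge> 3"
  shows "{vs ! (length vs - 1), vs ! 0} \<notin> path_edges vs 0 (length vs - 1)"
proof
  assume "{vs ! (length vs - 1), vs ! 0} \<in> path_edges vs 0 (length vs - 1)"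
  then obtain k where k: "k < length vs - 1" "{vs ! (length vs - 1), vs ! 0} = {vs ! k, vs ! Suc k}"
    by (auto simp: path_edges_def)
  then have "vs ! 0 = vs ! k" "vs ! (length vs - 1) = vs ! Suc k"
    using assms by (auto simp: doubleton_eq_iff nth_eq_iff_index_eq)
  then have "0 = k"
    using assms k(1) by (subst (asm) nth_eq_iff_index_eq) auto
  moreover have "length vs - 1 = Suc k"
    using assms k(1) \<open>vs ! (length vs - 1) = vs ! Suc k\<close>
    by (subst (asm) nth_eq_iff_index_eq) auto
  ultimately show False using assms by simp
qed

lemma cycleE:
  assumes "cycle E C"
  obtains vs where "distinct vs" "length vs \<ge> 3" "C \<subseteq> E" "\<Union>C = set vs" "card C = length vs"
    "C = insert {vs ! (length vs - 1), vs ! 0} (path_edges vs 0 (length vs - 1))"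
proof -
  obtain vs where vs: "distinct vs" "length vs \<ge> 3" "C \<subseteq> E"
      "C = {{vs ! i, vs ! (Suc i mod length vs)} | i. i < length vs}"
    using assms unfolding cycle_def by blast
  have C: "C = insert {vs ! (length vs - 1), vs ! 0} (path_edges vs 0 (length vs - 1))"
    using vs(4) cycle_edges[OF vs(2)] by simp
  have "card C = length vs"
    unfolding C using closing_edge_notin_path[OF vs(1,2)] path_edges_parity_card(2)[OF vs(1), of 0 "length vs - 1"] vs(2)
    by simp
  moreover have "\<Union>C = set vs"
  proof
    have "vs ! i \<in> set vs" "vs ! (Suc i mod length vs) \<in> set vs" if "i < length vs" for i
      using that by (auto intro!: nth_mem mod_less_divisor)
    then show "\<Union>C \<subseteq> set vs" unfolding vs(4) by auto
    show "set vs \<subseteq> \<Union>C"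
    proof
      fix v assume "v \<in> set vs"
      then obtain i where "i < length vs" "v = vs ! i" by (auto simp: in_set_conv_nth)
      then show "v \<in> \<Union>C" unfolding vs(4) by blast
    qed
  qed
  ultimately show thesis using that vs C by blast
qed

lemma cycle_card: "cycle E C \<Longrightarrow> 3 \<le> card C"
  by (erule cycleE) linarith

lemma cycleI:
  assumes "distinct vs" "length vs \<ge> 3"
    and "path_edges vs 0 (length vs - 1) \<subseteq> E" "{vs ! (length vs - 1), vs ! 0} \<in> E"
  shows "cycle E (insert {vs ! (length vs - 1), vs ! 0} (path_edges vs 0 (length vs - 1)))"
  unfolding cycle_def
proof (intro conjI exI[of _ vs])
  show "insert {vs ! (length vs - 1), vs ! 0} (path_edges vs 0 (length vs - 1)) \<subseteq> E"
    using assms(3,4) by simp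
  show "insert {vs ! (length vs - 1), vs ! 0} (path_edges vs 0 (length vs - 1)) =
      {{vs ! i, vs ! (Suc i mod length vs)} | i. i < length vs}"
    using cycle_edges[OF assms(2)] by (rule sym)
qed (use assms in auto)

text \<open>The witness \<open>P\<close> is one of the two paths into which \<open>u\<close> and \<open>v\<close> divide the cycle.\<close>

lemma cycle_split:
  assumes "cycle E C" "u \<in> \<Union>C" "v \<in> \<Union>C" "u \<noteq> v"
  obtains P where "P \<subseteq> C" "\<And>w. odd_at P w \<longleftrightarrow> w = u \<or> w = v"
proof -
  obtain vs where vs: "distinct vs" "length vs \<ge> 3" "\<Union>C = set vs"
      "C = insert {vs ! (length vs - 1), vs ! 0} (path_edges vs 0 (length vs - 1))"
    using assms(1) by (rule cycleE) (rule that)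
  obtain i j where ij: "i < length vs" "j < length vs" "u = vs ! i" "v = vs ! j"
    using assms(2,3) vs(3) by (auto simp: in_set_conv_nth)
  have sub: "path_edges vs k l \<subseteq> C" if "l < length vs" for k l
    using that by (auto simp: vs(4) path_edges_def)
  show thesis
  proof (cases "i \<le> j")
    case True
    show thesis
    proof (rule that[OF sub[OF ij(2)]])
      show "odd_at (path_edges vs i j) w \<longleftrightarrow> w = u \<or> w = v" for w
        unfolding path_edges_parity_card(1)[OF vs(1) True ij(2)] using ij(3,4) assms(4) by metis
    qed
  next
    case False
    then have "j \<le> i" by simp
    show thesis
    proof (rule that[OF sub[OF ij(1)]])
      show "odd_at (path_edges vs j i) w \<longleftrightarrow> w = u \<or> w = v" for w
        unfolding path_edges_parity_card(1)[OF vs(1) \<open>j \<le> i\<close> ij(1)] using ij(3,4) assms(4) by metis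
    qed
  qed
qed

text \<open>Every second edge of an even cycle belongs to \<open>M\<close>.\<close>

lemma cycle_matching:
  assumes "cycle E C" "card C = 2 * d"
  obtains M where "M \<subseteq> C" "card M = d" "\<And>e f. e \<in> M \<Longrightarrow> f \<in> M \<Longrightarrow> e \<noteq> f \<Longrightarrow> e \<inter> f = {}"
proof -
  obtain vs where vs: "distinct vs" "card C = length vs"
      "C = insert {vs ! (length vs - 1), vs ! 0} (path_edges vs 0 (length vs - 1))"
    using assms(1) by (rule cycleE) (rule that)
  let ?e = "\<lambda>i. {vs ! (2 * i), vs ! Suc (2 * i)}"
  have disj: "?e i \<inter> ?e j = {}" if ij: "i < d" "j < d" "i \<noteq> j" for i j
  proof -
    have "2 * i \<noteq> Suc (2 * j)" "Suc (2 * i) \<noteq> 2 * j" by presburger+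
    moreover have "2 * i < length vs" "Suc (2 * i) < length vs" "2 * j < length vs" "Suc (2 * j) < length vs"
      using ij vs(2) assms(2) by auto
    ultimately show ?thesis
      using ij(3) vs(1) by (auto simp: nth_eq_iff_index_eq)
  qed
  show thesis
  proof (rule that[of "?e ` {..<d}"])
    show "?e ` {..<d} \<subseteq> C"
      using vs(2) assms(2) by (auto simp: vs(3) path_edges_def)
    have "inj_on ?e {..<d}"
      using disj by (intro inj_onI) (metis Int_absorb insert_not_empty lessThan_iff)
    then show "card (?e ` {..<d}) = d"
      by (simp add: card_image)
    show "e \<inter> f = {}" if "e \<in> ?e ` {..<d}" "f \<in> ?e ` {..<d}" "e \<noteq> f" for e f
      using that disj by blast
  qed
qed

text \<open>Every vertex of a cycle is on two of its edges only, so a subset with even degrees that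
  contains an edge also contains the next one.\<close>

lemma cycle_minimal:
  assumes C: "cycle E C" and D: "D \<subseteq> C" "D \<noteq> {}" "\<And>v. \<not> odd_at D v"
  shows "D = C"
proof -
  obtain vs where vs: "distinct vs" "length vs \<ge> 3"
      "C = {{vs ! i, vs ! (Suc i mod length vs)} | i. i < length vs}"
    using C unfolding cycle_def by blast
  let ?n = "length vs"
  let ?e = "\<lambda>i. {vs ! i, vs ! (Suc i mod ?n)}"
  have step: "?e (Suc k mod ?n) \<in> D" if k: "k < ?n" "?e k \<in> D" for k
  proof (rule ccontr)
    let ?k = "Suc k mod ?n"
    assume no: "?e ?k \<notin> D"
    have "?k < ?n" using vs(2) by (intro mod_less_divisor) linarith
    have "e = ?e k" if e: "e \<in> D" "vs ! ?k \<in> e" for e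
    proof -
      obtain m where m: "m < ?n" "e = ?e m"
        using e(1) D(1) vs(3) by blast
      have "Suc m mod ?n < ?n" using vs(2) by (intro mod_less_divisor) linarith
      then have "?k = m \<or> ?k = Suc m mod ?n"
        using e(2) m \<open>?k < ?n\<close> vs(1) by (auto simp: nth_eq_iff_index_eq)
      moreover have "?k \<noteq> m" using no e(1) m by blast
      ultimately have "?k = Suc m mod ?n" by blast
      then have "k = m"
        using k(1) m(1) by (simp add: mod_Suc split: if_splits)
      then show ?thesis using m by blast
    qed
    moreover have "vs ! ?k \<in> ?e k" by simp
    ultimately have only: "{e \<in> D. vs ! ?k \<in> e} = {?e k}" using k(2) by blast
    have "odd_at D (vs ! ?k)" unfolding odd_at_def only by simp
    then show False using D(3) by blast
  qed
  obtain k where k: "k < ?n" "?e k \<in> D" using D vs(3) by blast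
  have reach: "?e ((k + t) mod ?n) \<in> D" for t
  proof (induction t)
    case 0
    then show ?case using k by simp
  next
    case (Suc t)
    have "(k + t) mod ?n < ?n" using k(1) by (intro mod_less_divisor) linarith
    from step[OF this Suc] show ?case by (simp add: mod_Suc_eq)
  qed
  have "?e m \<in> D" if "m < ?n" for m
    using reach[of "m + ?n - k"] that k by simp
  then show ?thesis using D(1) vs(3) by blast
qed

context graph
begin

lemma eulerian_iff: "eulerian V E C \<longleftrightarrow> C \<subseteq> E \<and> (\<forall>v. \<not> odd_at C v)"
proof -
  have "\<not> odd_at C v" if "C \<subseteq> E" "v \<notin> V" for v
  proof -
    have none: "{e \<in> C. v \<in> e} = {}" using that edge_subset by blast
    show ?thesis unfolding odd_at_def none by simp
  qed
  then show ?thesis by (auto simp: eulerian_def odd_at_def)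
qed

lemma finite_eulerian: "eulerian V E C \<Longrightarrow> finite C"
  using finite_E finite_subset by (auto simp: eulerian_def)

lemma eulerian_Un: "eulerian V E A \<Longrightarrow> eulerian V E B \<Longrightarrow> A \<inter> B = {} \<Longrightarrow> eulerian V E (A \<union> B)"
  using odd_at_Un[OF finite_eulerian finite_eulerian, of A B] by (auto simp: eulerian_iff)

lemma eulerian_Diff: "eulerian V E A \<Longrightarrow> eulerian V E B \<Longrightarrow> B \<subseteq> A \<Longrightarrow> eulerian V E (A - B)"
  using odd_at_Diff[OF finite_eulerian, of A B] by (auto simp: eulerian_iff)

lemma cycle_eulerian:
  assumes "cycle E C"
  shows "eulerian V E C"
proof -
  obtain vs where vs: "distinct vs" "length vs \<ge> 3" "C \<subseteq> E"
      "C = insert {vs ! (length vs - 1), vs ! 0} (path_edges vs 0 (length vs - 1))"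
    using assms by (rule cycleE) (rule that)
  have ne: "vs ! 0 \<noteq> vs ! (length vs - 1)"
  proof
    assume "vs ! 0 = vs ! (length vs - 1)"
    then have "0 = length vs - 1"
      using vs(1,2) by (subst (asm) nth_eq_iff_index_eq) auto
    then show False using vs(2) by simp
  qed
  have "odd_at C v \<longleftrightarrow> (v \<in> {vs ! (length vs - 1), vs ! 0}) \<noteq> ((v = vs ! 0) \<noteq> (v = vs ! (length vs - 1)))" for v
    unfolding vs(4) using vs(1,2) closing_edge_notin_path[OF vs(1,2)]
    by (simp add: odd_at_insert path_edges_parity_card)
  then show ?thesis
    using ne vs(3) by (auto simp: eulerian_iff)
qed

text \<open>The first vertex of a longest path lies on a further edge, whose other end must lie on
  the path.\<close>

lemma eulerian_contains_cycle:
  assumes C: "eulerian V E C" "C \<noteq> {}"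
  obtains Z where "cycle E Z" "Z \<subseteq> C"
proof -
  define path where "path = (\<lambda>vs. distinct vs \<and> 2 \<le> length vs \<and> set vs \<subseteq> V \<and>
    (\<forall>i. Suc i < length vs \<longrightarrow> {vs ! i, vs ! Suc i} \<in> C))"
  have CE: "C \<subseteq> E" using C by (simp add: eulerian_def)
  obtain e where e: "e \<in> C" using C by blast
  then obtain x y where "e = {x, y}" "x \<noteq> y"
    using CE edge_card by (metis card_2_iff subsetD)
  then have "path [x, y]"
    using e CE edge_subset by (auto simp: path_def less_Suc_eq)
  moreover have "\<forall>vs. path vs \<longrightarrow> length vs < Suc (card V)"
    using finite_V by (auto simp: path_def less_Suc_eq_le intro: card_mono simp flip: distinct_card)
  ultimately obtain vs where vs: "path vs" and longest: "\<And>us. path us \<Longrightarrow> length us \<le> length vs"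
    using ex_has_greatest_nat[of path "[x, y]" length "Suc (card V)"] by blast
  let ?x = "vs ! 0"
  have first: "{?x, vs ! 1} \<in> C" using vs by (auto simp: path_def)
  have "\<exists>f\<in>C. ?x \<in> f \<and> f \<noteq> {?x, vs ! 1}"
  proof (rule ccontr)
    assume none: "\<not> ?thesis"
    have "?x \<in> {?x, vs ! 1}" by simp
    then have only: "{f \<in> C. ?x \<in> f} = {{?x, vs ! 1}}" using first none by blast
    have "odd_at C ?x" unfolding odd_at_def only by simp
    then show False using C by (simp add: eulerian_iff)
  qed
  then obtain f where f: "f \<in> C" "?x \<in> f" "f \<noteq> {?x, vs ! 1}" by blast
  have "card f = 2" using f(1) CE edge_card by blast
  then obtain a b where ab: "f = {a, b}" "a \<noteq> b" by (auto simp: card_2_iff)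
  then have "?x = a \<or> ?x = b" using f(2) by blast
  then obtain y where y: "f = {?x, y}" "y \<noteq> ?x"
    using ab by (metis insert_commute)
  have "y \<in> set vs"
  proof (rule ccontr)
    assume "y \<notin> set vs"
    then have "path (y # vs)"
      using vs f y CE edge_subset by (auto simp: path_def nth_Cons insert_commute split: nat.splits)
    from longest[OF this] show False by simp
  qed
  then obtain j where j: "j < length vs" "y = vs ! j" by (auto simp: in_set_conv_nth)
  have "j \<noteq> 0" "j \<noteq> 1" using j f y by auto
  then have j2: "2 \<le> j" by simp
  define us where "us = take (Suc j) vs"
  have us: "distinct us" "length us = Suc j" "us ! (length us - 1) = y" "us ! 0 = ?x"
    using vs j by (auto simp: us_def path_def)
  have sub: "path_edges us 0 (length us - 1) \<subseteq> C"
    using vs j by (auto simp: path_edges_def us_def path_def)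
  show thesis
  proof (rule that)
    show "cycle E (insert {us ! (length us - 1), us ! 0} (path_edges us 0 (length us - 1)))"
      using us j2 sub f y CE by (intro cycleI) (auto simp: insert_commute)
    show "insert {us ! (length us - 1), us ! 0} (path_edges us 0 (length us - 1)) \<subseteq> C"
      using us sub f y by (auto simp: insert_commute)
  qed
qed

lemma eulerian_card_ge_3:
  assumes "eulerian V E C" "C \<noteq> {}"
  shows "3 \<le> card C"
proof -
  obtain Z where Z: "cycle E Z" "Z \<subseteq> C"
    using eulerian_contains_cycle[OF assms] by blast
  show ?thesis
    using cycle_card[OF Z(1)] card_mono[OF finite_eulerian[OF assms(1)] Z(2)] by linarith
qed

text \<open>Split off cycles one at a time: an even one has to be everything, and if there are two odd
  ones then these are everything. If the latter meet in two vertices \<open>u\<close> and \<open>v\<close>, both of them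
  consist of an even and an odd path from \<open>u\<close> to \<open>v\<close>, and the union of the two even paths is a
  smaller even Eulerian set.\<close>

lemma indecomposable_even_eulerian:
  assumes C: "eulerian V E C" "even (card C)" "C \<noteq> {}"
    and indec: "\<And>D. eulerian V E D \<Longrightarrow> even (card D) \<Longrightarrow> D \<subseteq> C \<Longrightarrow> D \<noteq> {} \<Longrightarrow> D = C"
  shows "even_cycle E C \<or> (\<exists>A B. odd_cycle E A \<and> odd_cycle E B \<and> A \<inter> B = {} \<and>
    card (\<Union>A \<inter> \<Union>B) \<le> 1 \<and> C = A \<union> B)"
proof -
  have nonempty: "Z \<noteq> {}" if "cycle E Z" for Z
    using that by (rule cycleE) auto
  have finC: "finite C" using C(1) by (rule finite_eulerian)
  obtain A where A: "cycle E A" "A \<subseteq> C"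
    using eulerian_contains_cycle C by blast
  show ?thesis
  proof (cases "even (card A)")
    case True
    then show ?thesis
      using indec[of A] A nonempty cycle_eulerian by (auto simp: even_cycle_def)
  next
    case oddA: False
    have euA: "eulerian V E A" using A(1) by (rule cycle_eulerian)
    have "C - A \<noteq> {}" using oddA C(2) A(2) by (metis Diff_eq_empty_iff subset_antisym)
    then obtain B where B: "cycle E B" "B \<subseteq> C - A"
      using eulerian_contains_cycle[OF eulerian_Diff[OF C(1) euA A(2)]] by blast
    have euB: "eulerian V E B" using B(1) by (rule cycle_eulerian)
    have AB: "A \<inter> B = {}" using B(2) by auto
    have fin: "finite A" "finite B" using euA euB finite_eulerian by auto
    have oddB: "odd (card B)"
    proof
      assume "even (card B)"
      then have "B = C" using indec[OF euB] B nonempty by blast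
      then show False using B(2) A nonempty by blast
    qed
    have "C = A \<union> B"
      using indec[OF eulerian_Un[OF euA euB AB]] oddA oddB A B nonempty
      by (auto simp: card_Un_disjoint[OF fin AB])
    moreover have "card (\<Union>A \<inter> \<Union>B) \<le> 1"
    proof (rule ccontr)
      assume many: "\<not> ?thesis"
      have "finite (\<Union>A \<inter> \<Union>B)"
        using many by (metis card.infinite zero_le)
      then obtain u v where uv: "u \<in> \<Union>A" "v \<in> \<Union>A" "u \<in> \<Union>B" "v \<in> \<Union>B" "u \<noteq> v"
        using many card_le_Suc0_iff_eq[of "\<Union>A \<inter> \<Union>B"] by auto
      have half: "\<exists>P\<subseteq>Z. even (card P) \<and> (\<forall>w. odd_at P w \<longleftrightarrow> w = u \<or> w = v)"
        if Z: "cycle E Z" "odd (card Z)" "u \<in> \<Union>Z" "v \<in> \<Union>Z" for Z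
      proof -
        obtain P where P: "P \<subseteq> Z" "\<And>w. odd_at P w \<longleftrightarrow> w = u \<or> w = v"
          using cycle_split[OF Z(1,3,4) uv(5)] by blast
        have euZ: "eulerian V E Z" using Z(1) by (rule cycle_eulerian)
        then have finZ: "finite Z" by (rule finite_eulerian)
        have "odd_at (Z - P) w \<longleftrightarrow> w = u \<or> w = v" for w
          using odd_at_Diff[OF finZ P(1), of w] P(2) euZ by (simp add: eulerian_iff)
        moreover have "even (card P) \<or> even (card (Z - P))"
          using Z(2) card_mono[OF finZ P(1)] card_Diff_subset[OF finite_subset[OF P(1) finZ] P(1)] by simp
        ultimately show ?thesis using P by blast
      qed
      obtain P Q where P: "P \<subseteq> A" "even (card P)" "\<forall>w. odd_at P w \<longleftrightarrow> w = u \<or> w = v"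
        and Q: "Q \<subseteq> B" "even (card Q)" "\<forall>w. odd_at Q w \<longleftrightarrow> w = u \<or> w = v"
        using half[OF A(1) oddA uv(1,2)] half[OF B(1) oddB uv(3,4)] by blast
      have finPQ: "finite P" "finite Q" "P \<inter> Q = {}"
        using P(1) Q(1) AB fin finite_subset by auto
      have "eulerian V E (P \<union> Q)"
        using P Q A B C(1) odd_at_Un[OF finPQ] by (auto simp: eulerian_iff)
      moreover have "even (card (P \<union> Q))"
        using P(2) Q(2) by (simp add: card_Un_disjoint[OF finPQ])
      moreover have "P \<noteq> {}" using P(3) odd_at_empty by metis
      moreover have "P \<union> Q \<subseteq> C" using P(1) Q(1) A(2) B(2) by auto
      ultimately have "P \<union> Q = C" using indec[of "P \<union> Q"] by blast
      then have "P = A" using P(1) Q(1) A(2) AB by blast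
      then show False using P(2) oddA by blast
    qed
    ultimately show ?thesis
      using A(1) B(1) oddA oddB AB by (auto simp: odd_cycle_def)
  qed
qed

text \<open>Every edge has exactly one end in \<open>X\<close>, so the degrees of the vertices in \<open>X\<close> sum to the
  number of edges.\<close>

lemma bipartite_eulerian_even:
  assumes "bipartite V E" "eulerian V E C"
  shows "even (card C)"
proof -
  obtain X Y where XY: "X \<union> Y = V" "X \<inter> Y = {}" "\<forall>e\<in>E. \<exists>x\<in>X. \<exists>y\<in>Y. e = {x, y}"
    using assms(1) unfolding bipartite_def by blast
  have fin: "finite X" "finite C"
    using XY(1) finite_V finite_eulerian[OF assms(2)] by auto
  have one: "(\<Sum>x\<in>X. of_bool (x \<in> e)) = (1 :: nat)" if e: "e \<in> C" for e
  proof -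
    have "e \<in> E" using e assms(2) by (auto simp: eulerian_def)
    then obtain x y where xy: "x \<in> X" "y \<in> Y" "e = {x, y}"
      using XY(3) by blast
    then have "(\<Sum>z\<in>X. of_bool (z \<in> e)) = (\<Sum>z\<in>X. if z = x then 1 else 0 :: nat)"
      using XY(2) by (intro sum.cong) auto
    then show ?thesis using xy fin by simp
  qed
  have "card C = (\<Sum>e\<in>C. \<Sum>x\<in>X. of_bool (x \<in> e))"
    by (simp add: one)
  also have "\<dots> = (\<Sum>x\<in>X. \<Sum>e\<in>C. of_bool (x \<in> e))"
    by (rule sum.swap)
  also have "\<dots> = (\<Sum>x\<in>X. card {e \<in> C. x \<in> e})"
    using fin by (simp add: Int_def)
  also have "even \<dots>"
    using assms(2) XY(1) by (intro dvd_sum) (auto simp: eulerian_def)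
  finally show ?thesis .
qed

text \<open>The ends of \<open>l\<close> divide the cycle into two paths, each of which forms a cycle with \<open>l\<close>. In
  a bipartite graph both of these are even.\<close>

lemma bipartite_chord_even_chord:
  assumes "bipartite V E" "cycle E C" "l \<in> E - C" "l \<subseteq> \<Union>C"
  shows "even_chord V E C l"
proof -
  obtain u v where uv: "l = {u, v}" "u \<noteq> v"
    using edge_card assms(3) by (metis DiffD1 card_2_iff)
  obtain P where P: "P \<subseteq> C" "\<And>w. odd_at P w \<longleftrightarrow> w = u \<or> w = v"
    using cycle_split[OF assms(2), of u v] assms(4) uv by auto
  have eu: "eulerian V E C" using assms(2) by (rule cycle_eulerian)
  have fin: "finite C" "finite P"
    using finite_eulerian[OF eu] P(1) finite_subset by auto
  have l: "l \<notin> P" "l \<notin> C - P" "l \<in> E" using P(1) assms(3) by auto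
  have C: "C \<subseteq> E" "\<not> odd_at C w" for w using eu by (auto simp: eulerian_iff)
  have "odd_at (insert l P) w = False" "odd_at (insert l (C - P)) w = False" for w
    using l C(2) P(2) uv(1) fin by (auto simp: odd_at_insert odd_at_Diff[OF fin(1) P(1)])
  then have "eulerian V E (insert l P)" "eulerian V E (insert l (C - P))"
    using C(1) P(1) l(3) by (auto simp: eulerian_iff)
  then have "eulerian V E (insert l P) \<and> even (card (insert l P)) \<and>
      eulerian V E (insert l (C - P)) \<and> even (card (insert l (C - P)))"
    using bipartite_eulerian_even[OF assms(1)] by blast
  moreover have "insert l P \<inter> insert l (C - P) = {l}" "C = sym_diff (insert l P) (insert l (C - P))"
    using P(1) assms(3) by auto
  ultimately show ?thesis
    unfolding even_chord_def using assms(3)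
    by (intro conjI exI[of _ "insert l P"] exI[of _ "insert l (C - P)"]) simp_all
qed

end


section \<open>Generators of bounded degree\<close>

definition set_mon :: "'x set \<Rightarrow> ('x \<Rightarrow>\<^sub>0 nat)" where
  "set_mon A = (\<Sum>x\<in>A. single x 1)"

lemma lookup_set_mon: "finite A \<Longrightarrow> lookup (set_mon A) x = (if x \<in> A then 1 else 0)"
  by (simp add: set_mon_def lookup_sum lookup_single when_def)

lemma keys_set_mon [simp]: "finite A \<Longrightarrow> keys (set_mon A) = A"
  by (auto simp: in_keys_iff lookup_set_mon split: if_splits)

lemma mon_deg_set_mon [simp]: "mon_deg (set_mon A) = card A"
  by (simp add: set_mon_def mon_deg_sum)

lemma squarefree_set_mon: "(\<And>x. lookup m x \<le> 1) \<Longrightarrow> m = set_mon (keys m)"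
proof (rule poly_mapping_eqI)
  fix x
  assume "\<And>x. lookup m x \<le> 1"
  then have "lookup m x \<le> 1" .
  then show "lookup m x = lookup (set_mon (keys m)) x"
    by (simp add: lookup_set_mon in_keys_iff)
qed

lemma set_mon_split: "finite A \<Longrightarrow> H \<subseteq> A \<Longrightarrow> set_mon A = set_mon (A - H) + set_mon H"
  unfolding set_mon_def by (rule sum.subset_diff)

lemma edge_sim_sym: "edge_sim E a b \<Longrightarrow> edge_sim E b a"
  by (simp add: edge_sim_def)

lemma edge_sim_trans: "edge_sim E a b \<Longrightarrow> edge_sim E b c \<Longrightarrow> edge_sim E a c"
  by (simp add: edge_sim_def)

lemma edge_sim_cancel: "edge_sim E (a + c) (b + c) \<Longrightarrow> edge_sim E a b"
  by (auto simp: edge_sim_def vdeg_add lookup_add keys_add_nat)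

lemma edge_sim_add: "edge_sim E a b \<Longrightarrow> keys c \<subseteq> E \<Longrightarrow> edge_sim E (a + c) (b + c)"
  by (auto simp: edge_sim_def vdeg_add lookup_add keys_add_nat)

context graph
begin

lemma lookup_vdeg_set_mon:
  assumes "A \<subseteq> E"
  shows "lookup (vdeg (set_mon A)) v = card {e \<in> A. v \<in> e}"
proof -
  have fin: "finite A" using assms finite_E finite_subset by blast
  have "lookup (vdeg (set_mon A)) v = (\<Sum>e\<in>A. if v \<in> e then lookup (set_mon A) e else 0)"
    using assms finite_edge fin lookup_vdeg[of "set_mon A" v] by auto
  also have "\<dots> = (\<Sum>e\<in>A. of_bool (v \<in> e))"
    using fin by (intro sum.cong) (auto simp: lookup_set_mon)
  finally show ?thesis using fin by (simp add: Int_def)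
qed

lemma edge_sim_squares: "e \<in> E \<Longrightarrow> f \<in> E \<Longrightarrow> edge_sim E (single e 2) (single f 2)"
proof -
  have "even (lookup (vdeg (single e 2)) v)" for e :: "'v set" and v
  proof -
    have "single e (2::nat) = single e 1 + single e 1"
      by (metis one_add_one single_add)
    then show ?thesis by (simp add: vdeg_add lookup_add)
  qed
  then show "e \<in> E \<Longrightarrow> f \<in> E \<Longrightarrow> edge_sim E (single e 2) (single f 2)"
    by (simp add: edge_sim_def)
qed

lemma edge_sim_swap:
  assumes A: "A \<subseteq> E" and D: "eulerian V E D" and H: "H \<subseteq> A" "H \<subseteq> D" "2 * card H = card D"
  shows "edge_sim E (set_mon A) (set_mon (A - H) + set_mon (D - H))"
proof -
  have fin: "finite A" "finite D"
    using A D finite_E finite_subset finite_eulerian by blast+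
  have DE: "D \<subseteq> E" using D by (simp add: eulerian_def)
  have "card (D - H) = card H"
    using H fin by (simp add: card_Diff_subset finite_subset)
  moreover have "even (lookup (vdeg (set_mon H)) v) = even (lookup (vdeg (set_mon (D - H))) v)" for v
  proof -
    have "even (lookup (vdeg (set_mon D)) v)"
      using D DE by (simp add: lookup_vdeg_set_mon eulerian_iff odd_at_def)
    then show ?thesis
      unfolding set_mon_split[OF fin(2) H(2)] by (simp add: vdeg_add lookup_add)
  qed
  ultimately have "edge_sim E (set_mon H) (set_mon (D - H))"
    using H(1,2) A DE fin finite_subset[OF H(1) fin(1)] by (auto simp: edge_sim_def)
  then have "edge_sim E (set_mon H + set_mon (A - H)) (set_mon (D - H) + set_mon (A - H))"
    using A fin by (intro edge_sim_add) auto
  then show ?thesis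
    using set_mon_split[OF fin(1) H(1)] by (simp add: add.commute)
qed

text \<open>This is where the combinatorial condition enters. The binomials of degree at most \<open>d\<close> are
  assumed to lie in the ideal \<open>S\<close>, and two monomials are connected if their difference does.

  By induction on the degree, monomials of the same class with a common variable are connected. A
  monomial divisible by the square of \<open>e\<close> is connected to everything in its class, since \<open>e\<^sup>2\<close>
  can be exchanged for \<open>f\<^sup>2\<close> with \<open>f\<close> in the other monomial. The remaining case is that of two squarefree monomials
  with disjoint sets \<open>A\<close> and \<open>B\<close> of variables, where \<open>A \<union> B\<close> is Eulerian. Given an even Eulerian
  set \<open>D\<close>, exchange half of \<open>D\<close>, taken from \<open>A\<close>, for the other half. The resulting monomial is
  connected to both if it contains a square and a variable of \<open>A\<close>, or variables of \<open>A\<close> and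
  of \<open>B\<close>. An even-chord or a proper nonempty even Eulerian subset of \<open>A \<union> B\<close> provides a suitable \<open>D\<close>.\<close>

lemma binomials_from_small_degree:
  fixes S :: "('v set, 'k::comm_ring_1) mpoly set"
  assumes S: "is_ideal (poly_ring E) S"
    and small: "\<And>a b. edge_sim E a b \<Longrightarrow> mon_deg a \<le> d \<Longrightarrow> monom a - monom b \<in> S"
    and d: "2 \<le> d"
    and big: "\<And>C. eulerian V E C \<Longrightarrow> even (card C) \<Longrightarrow> 2 * d < card C \<Longrightarrow>
      (\<exists>l. even_chord V E C l) \<or> (\<exists>D. eulerian V E D \<and> even (card D) \<and> D \<subset> C \<and> D \<noteq> {})"
    and "edge_sim E a b"
  shows "monom a - monom b \<in> S"
  using \<open>edge_sim E a b\<close>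
proof (induction "mon_deg a" arbitrary: a b rule: less_induct)
  case less
  define r where "r = mon_deg a"
  show ?case
  proof (cases "r \<le> d")
    case True
    then show ?thesis using small less.prems by (simp add: r_def)
  next
    case False
    define L where "L a b \<longleftrightarrow> monom a - monom b \<in> S" for a b
    have L_trans: "L x z" if "L x y" "L y z" for x y z
    proof -
      have "(monom x - monom y) + (monom y - monom z) \<in> S"
        using that S unfolding L_def is_ideal_def by blast
      then show ?thesis by (simp add: L_def)
    qed
    have L_sym: "L y x" if "L x y" for x y
    proof -
      have "0 \<in> S" using S by (simp add: is_ideal_def)
      then have "0 - (monom x - monom y) \<in> S"
        using that unfolding L_def by (rule is_ideal_diff[OF S])
      then show ?thesis by (simp add: L_def)
    qed
    have L_add: "L (c + x) (c + y)" if "L x y" "keys c \<subseteq> E" for x y c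
    proof -
      have "monom c * (monom x - monom y) \<in> S"
        using that by (intro is_ideal_mult_monom[OF S]) (auto simp: L_def)
      then show ?thesis by (simp add: L_def right_diff_distrib mult_single)
    qed
    have share: "L x y" if sim: "edge_sim E x y" and r: "mon_deg x = r" and e: "e \<in> keys x" "e \<in> keys y" for x y e
    proof -
      have "1 \<le> lookup x e" "1 \<le> lookup y e" using e by (auto simp: in_keys_iff)
      then obtain x' y' where xy: "x = x' + single e 1" "y = y' + single e 1"
        using mon_split_power by metis
      have "edge_sim E x' y'" using sim xy edge_sim_cancel by blast
      moreover have "mon_deg x' < mon_deg a" using r xy by (simp add: r_def)
      ultimately have "L x' y'" using less.hyps by (simp add: L_def)
      moreover have "keys (single e (1::nat)) \<subseteq> E" using sim e by (auto simp: edge_sim_def)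
      ultimately show ?thesis unfolding xy using L_add by (metis add.commute)
    qed
    have square: "L x y" if sim: "edge_sim E x y" and r: "mon_deg x = r" and e: "2 \<le> lookup x e" for x y e
    proof -
      have "mon_deg y = r" using sim r by (simp add: edge_sim_def)
      then have "y \<noteq> 0" using False d by auto
      then obtain f where f: "f \<in> keys y" using keys_nonempty by blast
      obtain x' where x: "x = x' + single e 2" using mon_split_power[OF e] by blast
      have E: "e \<in> E" "f \<in> E" "keys x' \<subseteq> E"
        using sim f by (auto simp: edge_sim_def x keys_add_nat)
      have ef: "edge_sim E (single e 2) (single f 2)" using E by (intro edge_sim_squares)
      then have "L (single e 2) (single f 2)" using small d by (simp add: L_def)
      then have "L x (x' + single f 2)" unfolding x using E(3) by (rule L_add)
      moreover have "edge_sim E x (x' + single f 2)"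
        using edge_sim_add[OF ef E(3)] by (simp add: x add.commute)
      then have "edge_sim E (x' + single f 2) y"
        using sim edge_sim_sym edge_sim_trans by blast
      then have "L (x' + single f 2) y"
        using f r by (intro share[of _ _ f]) (auto simp: x keys_add_nat)
      ultimately show ?thesis by (rule L_trans)
    qed
    have via: "L x y" if sim: "edge_sim E x y" "edge_sim E x c" and r: "mon_deg x = r"
      and e: "e \<in> keys x" "e \<in> keys c" and f: "2 \<le> lookup c f \<or> f \<in> keys c \<and> f \<in> keys y" for x y c e f
    proof -
      have "L x c" using share[OF sim(2) r e] .
      moreover have "edge_sim E c y" "mon_deg c = r"
        using sim r edge_sim_sym edge_sim_trans by (blast, simp add: edge_sim_def)
      then have "L c y" using f square share by blast
      ultimately show ?thesis by (rule L_trans)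
    qed
    have exchange: "L (set_mon A) (set_mon B)"
      if sim: "edge_sim E (set_mon A) (set_mon B)" and AB: "A \<subseteq> E" "B \<subseteq> E" "card A = r"
        and D: "eulerian V E D" "even (card D)"
        and half: "card D < 2 * card (A \<inter> D) \<or>
          card D = 2 * card (A \<inter> D) \<and> \<not> A \<subseteq> D \<and> B \<inter> D \<noteq> {}" for A B D
    proof -
      have fin: "finite A" "finite B" "finite D"
        using AB(1,2) finite_E finite_subset finite_eulerian[OF D(1)] by auto
      \<comment> \<open>\<open>H\<close> is the half of \<open>D\<close> that is taken out of \<open>A\<close>.\<close>
      obtain h where h: "card D = 2 * h" using D(2) by auto
      then have "h \<le> card (A \<inter> D)" using half by auto
      then obtain H where H: "H \<subseteq> A \<inter> D" "card H = h"
        by (meson obtain_subset_with_card_n)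
      let ?c = "set_mon (A - H) + set_mon (D - H)"
      have c: "edge_sim E (set_mon A) ?c"
        using H h by (intro edge_sim_swap[OF AB(1) D(1)]) auto
      from half show ?thesis
      proof
        assume "card D < 2 * card (A \<inter> D)"
        then have "H \<noteq> A \<inter> D" using h H(2) by auto
        then obtain e where e: "e \<in> A" "e \<in> D" "e \<notin> H" using H(1) by blast
        then have "2 \<le> lookup ?c e" "e \<in> keys ?c"
          using fin by (auto simp: lookup_add lookup_set_mon keys_add_nat)
        then show ?thesis
          using AB(3) e(1) fin by (intro via[OF sim c, of e e]) simp_all
      next
        assume *: "card D = 2 * card (A \<inter> D) \<and> \<not> A \<subseteq> D \<and> B \<inter> D \<noteq> {}"
        then obtain e f where ef: "e \<in> A" "e \<notin> D" "f \<in> B" "f \<in> D" by blast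
        show ?thesis
        proof (cases "f \<in> A")
          case True
          then show ?thesis
            using share[OF sim, of f] AB(3) ef(3) fin by simp
        next
          case False
          then have "e \<in> keys ?c" "f \<in> keys ?c"
            using ef H(1) fin by (auto simp: keys_add_nat)
          then show ?thesis
            using AB(3) ef fin by (intro via[OF sim c, of e f]) simp_all
        qed
      qed
    qed
    have by_subset: "L (set_mon A) (set_mon B)"
      if sim: "edge_sim E (set_mon A) (set_mon B)" and AB: "A \<subseteq> E" "B \<subseteq> E" "A \<inter> B = {}" "card A = r" "card B = r"
        and D: "eulerian V E D" "even (card D)" "D \<subset> A \<union> B" "D \<noteq> {}" for A B D
    proof -
      have fin: "finite A" "finite B"
        using AB(1,2) finite_E finite_subset by blast+
      have "D = (A \<inter> D) \<union> (B \<inter> D)" using D(3) by blast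
      then have cD: "card D = card (A \<inter> D) + card (B \<inter> D)"
        using fin AB(3) by (metis (no_types, lifting) card_Un_disjoint finite_Int inf_assoc inf_bot_left inf_left_commute)
      consider "card (A \<inter> D) > card (B \<inter> D)" | "card (B \<inter> D) > card (A \<inter> D)"
        | "card (A \<inter> D) = card (B \<inter> D)" by linarith
      then show ?thesis
      proof cases
        case 1
        then show ?thesis using cD by (intro exchange[OF sim AB(1,2,4) D(1,2)]) simp
      next
        case 2
        then have "L (set_mon B) (set_mon A)"
          using cD by (intro exchange[OF edge_sim_sym[OF sim] AB(2,1,5) D(1,2)]) simp
        then show ?thesis by (rule L_sym)
      next
        case 3
        have "card D \<noteq> 0" using D(4) finite_eulerian[OF D(1)] by simp
        then have "B \<inter> D \<noteq> {}" using cD 3 by auto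
        moreover have "\<not> A \<subseteq> D"
        proof
          assume "A \<subseteq> D"
          then have "card (B \<inter> D) = card B" using 3 AB(4,5) by (simp add: Int_absorb2)
          then have "B \<inter> D = B" using fin by (intro card_subset_eq) auto
          then show False using D(3) \<open>A \<subseteq> D\<close> by blast
        qed
        ultimately show ?thesis using cD 3 by (intro exchange[OF sim AB(1,2,4) D(1,2)]) simp
      qed
    qed
    have by_chord: "L (set_mon A) (set_mon B)"
      if sim: "edge_sim E (set_mon A) (set_mon B)" and AB: "A \<subseteq> E" "B \<subseteq> E" "A \<inter> B = {}" "card A = r" "card B = r"
        and C: "eulerian V E C1" "even (card C1)" "eulerian V E C2" "even (card C2)"
          "C1 \<inter> C2 = {l}" "A \<union> B = sym_diff C1 C2"
        and more: "card (A \<inter> C1) > card (B \<inter> C1)" for A B C1 C2 l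
    proof -
      have fin: "finite A" "finite B"
        using AB(1,2) finite_E finite_subset by blast+
      have l: "l \<notin> A" "l \<notin> B" using C(5,6) by blast+
      have "C1 = insert l ((A \<inter> C1) \<union> (B \<inter> C1))" using C(5,6) by blast
      moreover have "card (insert l ((A \<inter> C1) \<union> (B \<inter> C1))) = Suc (card (A \<inter> C1) + card (B \<inter> C1))"
        using fin l AB(3) by (subst card_insert_disjoint) (auto intro!: card_Un_disjoint)
      ultimately have c1: "card C1 = Suc (card (A \<inter> C1) + card (B \<inter> C1))" by simp
      show ?thesis
      proof (cases "card C1 < 2 * card (A \<inter> C1)")
        case True
        then show ?thesis by (intro exchange[OF sim AB(1,2,4) C(1,2)]) simp
      next
        case False
        then have eq: "card (A \<inter> C1) = Suc (card (B \<inter> C1))" using c1 more by simp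
        \<comment> \<open>Two edges of a simple graph do not form an Eulerian set. For \<open>C1\<close> this yields an edge
          of \<open>B\<close>, and for \<open>C2\<close> an edge of \<open>A\<close> outside \<open>C1\<close>.\<close>
        have "3 \<le> card C1" using C(1,5) by (intro eulerian_card_ge_3) auto
        then have "B \<inter> C1 \<noteq> {}" using c1 eq by auto
        moreover have "\<not> A \<subseteq> C1"
        proof
          assume sub: "A \<subseteq> C1"
          then have "C2 = insert l (B - B \<inter> C1)" using C(5,6) by blast
          then have "card C2 = Suc (card B - card (B \<inter> C1))"
            using fin l by (simp add: card_Diff_subset)
          also have "\<dots> = 2" using eq sub AB(4,5) by (simp add: Int_absorb2)
          finally show False using eulerian_card_ge_3[OF C(3)] C(5) by auto
        qed
        ultimately show ?thesis using c1 eq by (intro exchange[OF sim AB(1,2,4) C(1,2)]) simp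
      qed
    qed
    have "L a b"
    proof -
      have degs: "mon_deg a = r" "mon_deg b = r" using less.prems by (auto simp: r_def edge_sim_def)
      note ba = edge_sim_sym[OF less.prems]
      show ?thesis
      proof (cases "(\<exists>e. 2 \<le> lookup a e) \<or> (\<exists>e. 2 \<le> lookup b e) \<or> keys a \<inter> keys b \<noteq> {}")
        case True
        then show ?thesis
          using square[OF less.prems degs(1)] square[OF ba degs(2)] share[OF less.prems degs(1)] L_sym by blast
      next
        case reduced: False
        define A where "A = keys a"
        define B where "B = keys b"
        have le: "lookup a e \<le> 1" "lookup b e \<le> 1" for e
          using reduced by (metis not_less_eq_eq numeral_2_eq_2 One_nat_def)+
        have a: "a = set_mon A" unfolding A_def by (rule squarefree_set_mon[OF le(1)])
        have b: "b = set_mon B" unfolding B_def by (rule squarefree_set_mon[OF le(2)])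
        have AB: "A \<subseteq> E" "B \<subseteq> E" "A \<inter> B = {}"
          using less.prems reduced by (auto simp: edge_sim_def A_def B_def)
        have cards: "card A = r" "card B = r"
          using degs mon_deg_set_mon[of A] mon_deg_set_mon[of B] unfolding a[symmetric] b[symmetric] by auto
        have fin: "finite A" "finite B" by (simp_all add: A_def B_def)
        have sim: "edge_sim E (set_mon A) (set_mon B)" using less.prems a b by simp
        have "odd_at A v = odd_at B v" for v
          using sim AB(1,2) by (simp add: edge_sim_def lookup_vdeg_set_mon odd_at_def)
        then have eu: "eulerian V E (A \<union> B)"
          using AB by (auto simp: eulerian_iff odd_at_Un[OF fin])
        have cAB: "card (A \<union> B) = 2 * r" using AB(3) cards fin by (simp add: card_Un_disjoint)
        then consider l where "even_chord V E (A \<union> B) l"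
          | D where "eulerian V E D" "even (card D)" "D \<subset> A \<union> B" "D \<noteq> {}"
          using big[OF eu] False by auto
        then have "L (set_mon A) (set_mon B)"
        proof cases
          case 1
          then obtain C1 C2 where C: "eulerian V E C1" "even (card C1)" "eulerian V E C2" "even (card C2)"
              "C1 \<inter> C2 = {l}" "A \<union> B = sym_diff C1 C2"
            unfolding even_chord_def by blast
          have l: "l \<notin> A" "l \<notin> B" using C(5,6) by blast+
          have "C1 = insert l ((A \<inter> C1) \<union> (B \<inter> C1))" using C(5,6) by blast
          moreover have "card (insert l ((A \<inter> C1) \<union> (B \<inter> C1))) = Suc (card (A \<inter> C1) + card (B \<inter> C1))"
            using fin l AB(3) by (subst card_insert_disjoint) (auto intro!: card_Un_disjoint)
          ultimately have "card C1 = Suc (card (A \<inter> C1) + card (B \<inter> C1))" by simp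
          \<comment> \<open>As \<open>C1\<close> is even and \<open>l\<close> is in neither half, the two halves share different numbers
            of edges with \<open>C1\<close>.\<close>
          then have "card (A \<inter> C1) \<noteq> card (B \<inter> C1)"
            using C(2) by auto
          then consider "card (A \<inter> C1) > card (B \<inter> C1)" | "card (B \<inter> C1) > card (A \<inter> C1)"
            by linarith
          then show ?thesis
          proof cases
            case 1
            then show ?thesis using by_chord[OF sim AB cards C] by blast
          next
            case 2
            have "B \<inter> A = {}" "B \<union> A = sym_diff C1 C2" using AB(3) C(6) by auto
            then have "L (set_mon B) (set_mon A)"
              using by_chord[OF edge_sim_sym[OF sim] AB(2,1) _ cards(2,1) C(1-5)] 2 by blast
            then show ?thesis by (rule L_sym)
          qed
        next
          case 2
          then show ?thesis using by_subset[OF sim AB cards] by blast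
        qed
        then show ?thesis by (simp add: a b)
      qed
    qed
    then show ?thesis by (simp add: L_def)
  qed
qed

lemma even_chord_free_eulerian:
  assumes "C \<in> even_chord_free V E"
  shows "eulerian V E C" "even (card C)" "4 \<le> card C"
proof -
  have "eulerian V E C \<and> even (card C) \<and> C \<noteq> {}"
  proof (cases "even_cycle E C")
    case True
    then show ?thesis
      using cycle_eulerian cycle_card[of E C] by (auto simp: even_cycle_def)
  next
    case False
    then obtain A B where AB: "odd_cycle E A" "odd_cycle E B" "A \<inter> B = {}" "C = A \<union> B"
      using assms unfolding even_chord_free_def by blast
    then have eu: "eulerian V E A" "eulerian V E B"
      using cycle_eulerian by (auto simp: odd_cycle_def)
    have "card C = card A + card B"
      unfolding AB(4) using AB(3) eu finite_eulerian by (intro card_Un_disjoint) auto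
    then show ?thesis
      using AB eu eulerian_Un by (auto simp: odd_cycle_def)
  qed
  then show *: "eulerian V E C" "even (card C)" by auto
  show "4 \<le> card C"
    using \<open>eulerian V E C \<and> even (card C) \<and> C \<noteq> {}\<close> eulerian_card_ge_3[of C]
    by (cases "card C = 3") auto
qed

lemma finite_even_chord_free: "finite (even_chord_free V E)"
proof (rule finite_subset)
  show "even_chord_free V E \<subseteq> Pow E"
    using even_chord_free_eulerian(1) by (auto simp: eulerian_def)
qed (simp add: finite_E)

definition small_binomials :: "nat \<Rightarrow> ('v set, 'k::comm_ring_1) mpoly set" where
  "small_binomials d = {monom a - monom b | a b. edge_sim E a b \<and> mon_deg a \<le> d}"

lemma finite_small_monomials: "finite {a :: 'v set \<Rightarrow>\<^sub>0 nat. keys a \<subseteq> E \<and> mon_deg a \<le> d}"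
proof (rule finite_imageD)
  let ?M = "{a :: 'v set \<Rightarrow>\<^sub>0 nat. keys a \<subseteq> E \<and> mon_deg a \<le> d}"
  have "lookup ` ?M \<subseteq> {f. \<forall>e. (e \<in> E \<longrightarrow> f e \<in> {..d}) \<and> (e \<notin> E \<longrightarrow> f e = 0)}"
  proof clarify
    fix a :: "'v set \<Rightarrow>\<^sub>0 nat" and e
    assume "keys a \<subseteq> E" "mon_deg a \<le> d"
    then show "(e \<in> E \<longrightarrow> lookup a e \<in> {..d}) \<and> (e \<notin> E \<longrightarrow> lookup a e = 0)"
      using lookup_le_mon_deg[of a e] by (auto simp: in_keys_iff)
  qed
  then show "finite (lookup ` ?M)"
    by (rule finite_subset) (intro finite_set_of_finite_funs finite_E finite_atMost)
  show "inj_on lookup ?M"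
    by (rule inj_onI) (rule poly_mapping_eqI, simp)
qed

lemma finite_small_binomials: "finite (small_binomials d :: ('v set, 'k::comm_ring_1) mpoly set)"
proof (rule finite_subset)
  let ?M = "{a :: 'v set \<Rightarrow>\<^sub>0 nat. keys a \<subseteq> E \<and> mon_deg a \<le> d}"
  show "small_binomials d \<subseteq> (\<lambda>(a, b). monom a - monom b :: ('v set, 'k) mpoly) ` (?M \<times> ?M)"
  proof
    fix g :: "('v set, 'k) mpoly"
    assume "g \<in> small_binomials d"
    then obtain a b where "g = monom a - monom b" "edge_sim E a b" "mon_deg a \<le> d"
      by (auto simp: small_binomials_def)
    then show "g \<in> (\<lambda>(a, b). monom a - monom b) ` (?M \<times> ?M)"
      by (intro image_eqI[of _ _ "(a, b)"]) (auto simp: edge_sim_def)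
  qed
qed (intro finite_imageI finite_cartesian_product finite_small_monomials)

lemma small_binomials_homogeneous:
  fixes g :: "('v set, 'k::comm_ring_1) mpoly"
  assumes "g \<in> small_binomials d"
  shows "homogeneous g" "total_deg g \<le> d"
proof -
  obtain a b where ab: "g = monom a - monom b" "edge_sim E a b" "mon_deg a \<le> d"
    using assms unfolding small_binomials_def by (elim CollectE exE conjE) (rule that)
  have "mon_deg m = mon_deg a" if "m \<in> keys g" for m
  proof -
    have "m = a \<or> m = b"
      using that by (rule contrapos_pp) (auto simp: ab(1) in_keys_iff lookup_minus lookup_single when_def)
    then show ?thesis using ab(2) by (auto simp: edge_sim_def)
  qed
  then show "homogeneous g" "total_deg g \<le> d"
    using ab(3) by (auto simp: homogeneous_def intro!: total_deg_leI)
qed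

lemma small_binomials_subset: "small_binomials d \<subseteq> eulerian_ideal V E"
  using edge_sim_diff_in_eulerian_ideal by (auto simp: small_binomials_def)

lemma eulerian_ideal_nonzero:
  assumes "eulerian V E C" "C \<noteq> {}"
  shows "eulerian_ideal V E \<noteq> {0 :: ('v set, 'k::comm_ring_1) mpoly}"
proof
  assume zero: "eulerian_ideal V E = {0 :: ('v set, 'k) mpoly}"
  have "\<not> card C \<le> Suc 0"
    using eulerian_card_ge_3[OF assms] by simp
  then obtain e f where ef: "e \<in> C" "f \<in> C" "e \<noteq> f"
    using card_le_Suc0_iff_eq[OF finite_eulerian[OF assms(1)]] by blast
  then have "edge_sim E (single e 2) (single f 2)"
    using assms(1) by (intro edge_sim_squares) (auto simp: eulerian_def)
  then have "monom (single e 2) - monom (single f 2) = (0 :: ('v set, 'k) mpoly)"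
    using edge_sim_diff_in_eulerian_ideal zero by blast
  then have "lookup (monom (single e 2) - monom (single f 2) :: ('v set, 'k) mpoly) (single e 2) = 0"
    by simp
  moreover have "single f (2 :: nat) \<noteq> single e 2"
  proof
    assume "single f (2 :: nat) = single e 2"
    then have "lookup (single f (2 :: nat)) e = lookup (single e 2) e" by simp
    then show False using ef(3) by (simp add: lookup_single)
  qed
  ultimately show False by (simp add: lookup_minus lookup_single)
qed

lemma eulerian_ideal_generated:
  assumes "even_chord_free V E \<noteq> {}" "2 * d = Max (card ` even_chord_free V E)"
  shows "ideal_gen (poly_ring E) (small_binomials d) = (eulerian_ideal V E :: ('v set, 'k::comm_ring_1) mpoly set)"
proof
  let ?I = "eulerian_ideal V E :: ('v set, 'k) mpoly set"
  let ?S = "ideal_gen (poly_ring E) (small_binomials d) :: ('v set, 'k) mpoly set"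
  note max = Max_ge[OF finite_imageI[OF finite_even_chord_free], of _ card, folded assms(2)]
  have I: "is_ideal (poly_ring E) ?I" by (rule is_ideal_eulerian_ideal)
  show "?S \<subseteq> ?I" by (intro ideal_gen_minimal I small_binomials_subset)
  have S: "is_ideal (poly_ring E) ?S"
    using small_binomials_subset by (intro is_ideal_ideal_gen) (auto simp: eulerian_ideal_def)
  show "?I \<subseteq> ?S"
  proof (rule eulerian_ideal_subset[OF S])
    obtain C where C: "C \<in> even_chord_free V E" using assms(1) by blast
    then have "4 \<le> 2 * d" using even_chord_free_eulerian(3) max by fastforce
    then have "2 \<le> d" by simp
    moreover have "monom a - monom b \<in> ?S" if "edge_sim E a b" "mon_deg a \<le> d" for a b
      using that ideal_gen_subset[of "small_binomials d" "poly_ring E"] by (auto simp: small_binomials_def)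
    moreover have "(\<exists>l. even_chord V E C l) \<or> (\<exists>D. eulerian V E D \<and> even (card D) \<and> D \<subset> C \<and> D \<noteq> {})"
      if C: "eulerian V E C" "even (card C)" "2 * d < card C" for C
    proof (rule ccontr)
      assume no: "\<not> ?thesis"
      have "C \<noteq> {}" using C(3) by auto
      then have "C \<in> even_chord_free V E"
        using indecomposable_even_eulerian[OF C(1,2)] no unfolding even_chord_free_def by blast
      then show False using max C(3) by fastforce
    qed
    ultimately show "monom a - monom b \<in> ?S" if "edge_sim E a b" for a b
      using binomials_from_small_degree[OF S] that by blast
  qed
qed


section \<open>Bipartite graphs\<close>

text \<open>In an induced even cycle \<open>C\<close> of a bipartite graph, every monomial properly dividing the
  product of the edges of a matching \<open>A\<close> is alone in its class: the parities and the degree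
  force another member of the class to be a second matching of the same vertices. Both matchings
  lie in \<open>C\<close>, and their symmetric difference is Eulerian and too small to be \<open>C\<close>.\<close>

lemma matching_divisor_isolated:
  assumes bip: "bipartite V E" and C: "cycle E C" "\<nexists>l. even_chord V E C l"
    and A: "A \<subseteq> C" "\<And>e f. e \<in> A \<Longrightarrow> f \<in> A \<Longrightarrow> e \<noteq> f \<Longrightarrow> e \<inter> f = {}" "2 * card A \<le> card C"
    and n: "set_mon A = m + n" "m \<noteq> 0" and sim: "edge_sim E n b"
  shows "b = n"
proof -
  have eC: "eulerian V E C" using C(1) by (rule cycle_eulerian)
  then have CE: "C \<subseteq> E" by (simp add: eulerian_def)
  have fin: "finite C" "finite A"
    using finite_eulerian[OF eC] finite_subset[OF A(1)] by simp_all
  define U where "U = keys n"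
  have n1: "lookup n e \<le> 1" for e
  proof -
    have "lookup n e \<le> lookup (set_mon A) e" by (simp add: n(1) lookup_add)
    then show ?thesis by (simp add: lookup_set_mon[OF fin(2)] split: if_splits)
  qed
  have nU: "n = set_mon U" unfolding U_def by (rule squarefree_set_mon[OF n1])
  have UA: "U \<subseteq> A"
    using fin(2) arg_cong[OF n(1), of keys] by (auto simp: U_def keys_add_nat)
  then have UE: "U \<subseteq> E" and finU: "finite U" using A(1) CE by (auto simp: U_def)
  have "card A = mon_deg m + card U"
    using arg_cong[OF n(1), of mon_deg] by (simp add: nU)
  moreover have "mon_deg m \<noteq> 0" using n(2) by simp
  ultimately have cU: "card U < card A" by linarith
  have vn: "lookup (vdeg n) v = card {e \<in> U. v \<in> e}" for v
    using lookup_vdeg_set_mon[OF UE] nU by simp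
  have vn1: "lookup (vdeg n) v \<le> 1" for v
  proof -
    have "e = f" if "e \<in> {e \<in> U. v \<in> e}" "f \<in> {e \<in> U. v \<in> e}" for e f
      using that A(2)[of e f] UA by blast
    moreover have fin_v: "finite {e \<in> U. v \<in> e}" using finU by simp
    ultimately have "card {e \<in> U. v \<in> e} \<le> Suc 0"
      unfolding card_le_Suc0_iff_eq[OF fin_v] by blast
    then show ?thesis by (simp add: vn)
  qed
  have le: "lookup (vdeg n) v \<le> lookup (vdeg b) v" for v
  proof -
    have "even (lookup (vdeg n) v) = even (lookup (vdeg b) v)"
      using sim by (simp add: edge_sim_def)
    then show ?thesis using vn1[of v] by (cases "lookup (vdeg b) v") (auto simp: le_Suc_eq)
  qed
  have keys: "keys n \<subseteq> E" "keys b \<subseteq> E" using sim by (auto simp: edge_sim_def)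
  have "mon_deg (vdeg n) = mon_deg (vdeg b)"
    using sim by (simp add: mon_deg_vdeg keys edge_sim_def)
  then have "sum (lookup (vdeg n)) V = sum (lookup (vdeg b)) V"
    using mon_deg_superset[OF finite_V keys_vdeg[OF keys(1)]] mon_deg_superset[OF finite_V keys_vdeg[OF keys(2)]]
    by simp
  then have veq: "lookup (vdeg n) v = lookup (vdeg b) v" if "v \<in> V" for v
    using sum_mono_inv[of "lookup (vdeg n)" V "lookup (vdeg b)" v] le that finite_V by blast
  have b_le: "lookup b e \<le> lookup (vdeg n) v" if e: "e \<in> E" "v \<in> e" for e v
  proof (cases "e \<in> keys b")
    case True
    have "lookup b e \<le> (\<Sum>f\<in>keys b. if v \<in> f then lookup b f else 0)"
      using True e(2) member_le_sum[of e "keys b" "\<lambda>f. if v \<in> f then lookup b f else 0"] by simp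
    also have "\<dots> = lookup (vdeg b) v"
      using keys(2) finite_edge by (intro lookup_vdeg[symmetric]) auto
    also have "\<dots> = lookup (vdeg n) v" using veq[OF subsetD[OF edge_subset[OF e(1)] e(2)]] by (rule sym)
    finally show ?thesis .
  qed (simp add: in_keys_iff)
  have b1: "lookup b e \<le> 1" for e
  proof (cases "e \<in> E")
    case True
    then obtain v where "v \<in> e" using edge_card by fastforce
    then show ?thesis using b_le[OF True] vn1 le_trans by blast
  next
    case False
    then have "e \<notin> keys b" using keys(2) by blast
    then show ?thesis by (simp add: in_keys_iff)
  qed
  define W where "W = keys b"
  have bW: "b = set_mon W" unfolding W_def by (rule squarefree_set_mon[OF b1])
  have finW: "finite W" and WE: "W \<subseteq> E" using keys by (auto simp: W_def)
  have WC: "W \<subseteq> C"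
  proof
    fix e assume e: "e \<in> W"
    have "v \<in> \<Union>C" if "v \<in> e" for v
    proof -
      have "lookup b e \<noteq> 0" using e by (simp add: W_def in_keys_iff)
      then have "card {f \<in> U. v \<in> f} \<noteq> 0"
        using b_le[OF subsetD[OF WE e] that] vn[of v] by linarith
      then have "{f \<in> U. v \<in> f} \<noteq> {}" by (metis card.empty)
      then show ?thesis using UA A(1) by blast
    qed
    then show "e \<in> C"
      using bipartite_chord_even_chord[OF bip C(1), of e] C(2) e WE by blast
  qed
  let ?D = "sym_diff U W"
  have "odd_at U v = odd_at W v" for v
    using sim UE WE by (simp add: edge_sim_def nU bW lookup_vdeg_set_mon odd_at_def)
  then have "\<not> odd_at ?D v" for v
    by (simp add: odd_at_sym_diff[OF finU finW])
  moreover have "?D \<subseteq> C" using UA A(1) WC by blast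
  moreover have "?D \<noteq> C"
  proof
    assume "?D = C"
    then have "card C \<le> card (U \<union> W)" using finU finW by (intro card_mono) auto
    also have "\<dots> \<le> card U + card W" by (rule card_Un_le)
    also have "card W = card U"
      using sim by (simp add: edge_sim_def nU bW)
    finally show False using cU A(3) by simp
  qed
  ultimately have "?D = {}" using cycle_minimal[OF C(1), of ?D] by blast
  then have "U = W" by blast
  then show ?thesis by (simp add: nU bW)
qed

text \<open>By the previous lemma no element of the ideal has a term that properly divides the product of
  a matching \<open>A\<close> of \<open>d\<close> edges in \<open>C\<close>. Hence this product does not occur in anything generated by
  elements of degree less than \<open>d\<close>, but it does occur in its difference with the product of the
  remaining edges of \<open>C\<close>.\<close>

lemma bipartite_generator_degree:
  fixes B :: "('v set, 'k::comm_ring_1) mpoly set"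
  assumes bip: "bipartite V E" and C: "C \<in> even_chord_free V E" "card C = 2 * d"
    and B: "min_hom_gens E (eulerian_ideal V E) B" "\<forall>b\<in>B. total_deg b \<le> D"
  shows "d \<le> D"
proof (rule ccontr)
  assume D: "\<not> d \<le> D"
  let ?I = "eulerian_ideal V E :: ('v set, 'k) mpoly set"
  have I: "is_ideal (poly_ring E) ?I" by (rule is_ideal_eulerian_ideal)
  have no_odd: "\<not> odd_cycle E Z" for Z
    using bipartite_eulerian_even[OF bip] cycle_eulerian by (auto simp: odd_cycle_def)
  have cyc: "cycle E C" "\<nexists>l. even_chord V E C l"
    using C(1) no_odd unfolding even_chord_free_def even_cycle_def by blast+
  have eC: "eulerian V E C" using cyc(1) by (rule cycle_eulerian)
  then have CE: "C \<subseteq> E" by (simp add: eulerian_def)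
  have finC: "finite C" using eC by (rule finite_eulerian)
  obtain A where A: "A \<subseteq> C" "card A = d" "\<And>e f. e \<in> A \<Longrightarrow> f \<in> A \<Longrightarrow> e \<noteq> f \<Longrightarrow> e \<inter> f = {}"
    using cycle_matching[OF cyc(1) C(2)] by metis
  have finA: "finite A" using A(1) finC by (rule finite_subset)
  have gen: "ideal_gen (poly_ring E) B = ?I"
    using B(1) by (simp add: min_hom_gens_def)
  \<comment> \<open>The members of the ideal in which the product of \<open>A\<close> does not occur form an ideal that
    contains everything of smaller degree.\<close>
  let ?J = "{p \<in> ?I. lookup p (set_mon A) = 0}"
  have "is_ideal (poly_ring E) ?J"
  proof (rule is_ideal_polyI)
    fix m :: "'v set \<Rightarrow>\<^sub>0 nat" and c :: 'k and p :: "('v set, 'k) mpoly"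
    assume m: "keys m \<subseteq> E" and p: "p \<in> ?J"
    have "lookup (single m c * p) (set_mon A) = 0"
    proof (cases "\<exists>n. set_mon A = m + n")
      case True
      then obtain n where n: "set_mon A = m + n" by blast
      have "lookup p n = 0"
      proof (cases "m = 0")
        case True
        then show ?thesis using p n by simp
      next
        case False
        show ?thesis
        proof (rule ccontr)
          assume "lookup p n \<noteq> 0"
          then have "n \<in> keys p" by (simp add: in_keys_iff)
          then obtain b where b: "b \<noteq> n" "edge_sim E n b"
            using eulerian_ideal_partner[of p n] p by blast
          have "2 * card A \<le> card C" using A(2) C(2) by simp
          from matching_divisor_isolated[OF bip cyc A(1,3) this n False b(2)] b(1)
          show False by blast
        qed
      qed
      then show ?thesis unfolding n lookup_monom_times by simp
    next
      case False
      then have "set_mon A \<notin> keys (single m c * p)"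
        using keys_monom_times[of m c p] by blast
      then show ?thesis by (simp add: in_keys_iff)
    qed
    then show "single m c * p \<in> ?J"
      using p m is_ideal_mult_monom[OF I] by blast
  qed (use I in \<open>auto simp: lookup_add is_ideal_def\<close>)
  moreover have "B \<subseteq> ?J"
  proof
    fix b assume b: "b \<in> B"
    have "b \<in> ?I" using b ideal_gen_subset[of B "poly_ring E"] unfolding gen by blast
    moreover have "set_mon A \<notin> keys b"
    proof
      assume "set_mon A \<in> keys b"
      from total_deg_ge[OF this] have "d \<le> total_deg b"
        unfolding mon_deg_set_mon A(2) .
      moreover have "total_deg b \<le> D" using B(2) b by blast
      ultimately show False using D by linarith
    qed
    ultimately show "b \<in> ?J" by (simp add: in_keys_iff)
  qed
  ultimately have "ideal_gen (poly_ring E) B \<subseteq> ?J" by (rule ideal_gen_minimal)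
  then have IJ: "?I \<subseteq> ?J" unfolding gen .
  \<comment> \<open>Exchange the half \<open>A\<close> of \<open>C\<close> for the other half.\<close>
  have "edge_sim E (set_mon A) (set_mon (A - A) + set_mon (C - A))"
    using A(1,2) C(2) CE by (intro edge_sim_swap[OF _ eC]) auto
  then have "monom (set_mon A) - monom (set_mon (C - A)) \<in> ?I"
    by (intro edge_sim_diff_in_eulerian_ideal) (simp add: set_mon_def)
  then have "lookup (monom (set_mon A) - monom (set_mon (C - A)) :: ('v set, 'k) mpoly) (set_mon A) = 0"
    using IJ by blast
  moreover have "set_mon (C - A) \<noteq> set_mon A"
  proof
    assume "set_mon (C - A) = set_mon A"
    then have "keys (set_mon (C - A)) = keys (set_mon A)" by simp
    then have "A = {}" using finA finC by auto
    then show False using A(2) D by simp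
  qed
  ultimately show False by (simp add: lookup_minus lookup_single)
qed

end

theorem theorem4p6:
  fixes n d :: nat and E :: "nat set set" and I :: "(nat set, 'k::field) mpoly set"
  assumes "simple_graph {1..n} E" and "card E \<ge> 2"
    and "I = eulerian_ideal {1..n} E"
    and "even_chord_free {1..n} E \<noteq> {}"
    and "2 * d = Max (card ` even_chord_free {1..n} E)"
  shows "max_gen_deg E I \<le> d \<and> (bipartite {1..n} E \<longrightarrow> max_gen_deg E I = d)"
proof -
  interpret graph "{1..n}" E
    by unfold_locales (rule assms(1))
  let ?V = "{1..n}" and ?G = "small_binomials d :: (nat set, 'k) mpoly set"
  have "2 * d \<in> card ` even_chord_free ?V E"
    unfolding assms(5) by (rule Max_in) (simp_all add: finite_even_chord_free assms(4) del: One_nat_def)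
  then obtain C where C: "C \<in> even_chord_free ?V E" "card C = 2 * d" by auto
  have "I \<noteq> {0}"
    unfolding assms(3) using even_chord_free_eulerian[OF C(1)]
    by (intro eulerian_ideal_nonzero[of C]) auto
  moreover have "?G \<subseteq> poly_ring E"
    using small_binomials_subset by (auto simp: eulerian_ideal_def)
  moreover have "\<forall>g\<in>?G. homogeneous g \<and> total_deg g \<le> d"
    using small_binomials_homogeneous by blast
  moreover have "ideal_gen (poly_ring E) ?G = I"
    unfolding assms(3) by (rule eulerian_ideal_generated[OF assms(4,5)])
  ultimately obtain B where B: "min_hom_gens E I B" "\<forall>b\<in>B. total_deg b \<le> max_gen_deg E I"
      and le: "max_gen_deg E I \<le> d"
    using max_gen_deg_attained[OF finite_small_binomials] by metis
  have "d \<le> max_gen_deg E I" if "bipartite ?V E"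
    using bipartite_generator_degree[OF that C] B unfolding assms(3) by blast
  then show ?thesis using le by auto
qed

end
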